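(* Let $\sigma=\sum_n\sigma_n$, $\tau=\sum_n\tau_n$ and $L=\sigma\tau+\tau\sigma$. Let $f(x)$ be the Taylor series (at $0$) of the function $\frac{1-e^{-\pi ix}}{x}$. The assignment $$H\mapsto\Big(\sum_n2n\,e_n\Big)+L,\qquad K\mapsto e^{\frac{\pi i}2H},\qquad E\mapsto\sigma,\qquad F\mapsto\frac{\tau}{2i}f(L)K$$ gives a well-defined action of $\overline U_q^H(\mathfrak{sl}(2))$ at $q=i$ on every finite-dimensional unitary module of $\Lambda$, and this action satisfies $K=q^H$.
   Context: $\Lambda$ is the path algebra over $\mathbb C$ of the quiver with vertices (idempotents) $e_n$, $n\in\mathbb Z$, and arrows $\sigma_n:e_n\to e_{n+1}$, $\tau_n:e_n\to e_{n-1}$, modulo the relations $\sigma_n\sigma_{n-1}=0$ and $\tau_n\tau_{n+1}=0$ for all $n$ (products are composition of operators, right factor first; so $\sigma_n=e_{n+1}\sigma_ne_n$, $\tau_n=e_{n-1}\tau_ne_n$). A finite-dimensional $\Lambda$-module $M$ is called unitary (unital) if $M=\bigoplus_ne_nM$; on such $M$ the sums $\sum_n\sigma_n$, $\sum_n\tau_n$, $\sum_n2ne_n$ are well-defined operators. $\overline U_q^H(\mathfrak{sl}(2))$ at $q=i$ is the $\mathbb C$-algebra generated by $E,F,H,K^{\pm1}$ with relations $KK^{-1}=K^{-1}K=1$, $KE=-EK$, $KF=-FK$, $[H,E]=2E$, $[H,F]=-2F$, $[E,F]=\frac{K-K^{-1}}{2i}$, $E^2=F^2=0$. On a module, $K=q^H$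 means $K=e^{\pi iH/2}$. *)

theory Defs
  imports
    "HOL-Complex_Analysis.Complex_Analysis"
    "HOL-Library.Poly_Mapping"
    "HOL-Library.Groups_Big_Fun"
begin

section \<open>Complex algebras, ideals and actions\<close>

text \<open>Associative algebras over the complex numbers, not necessarily with a unit.\<close>

class complex_algebra = ring +
  fixes scaleC :: "complex \<Rightarrow> 'a \<Rightarrow> 'a" (infixr "*\<^sub>C" 75)
  assumes scaleC_add_right: "c *\<^sub>C (x + y) = c *\<^sub>C x + c *\<^sub>C y"
    and scaleC_add_left: "(c + d) *\<^sub>C x = c *\<^sub>C x + d *\<^sub>C x"
    and scaleC_scaleC: "c *\<^sub>C d *\<^sub>C x = (c * d) *\<^sub>C x"
    and scaleC_one: "1 *\<^sub>C x = x"
    and mult_scaleC_left: "(c *\<^sub>C x) * y = c *\<^sub>C (x * y)"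
    and mult_scaleC_right: "x * (c *\<^sub>C y) = c *\<^sub>C (x * y)"

definition two_sided_ideal ::
  "(complex \<Rightarrow> 'a \<Rightarrow> 'a) \<Rightarrow> ('a \<Rightarrow> 'a \<Rightarrow> 'a) \<Rightarrow> 'a::ab_group_add set \<Rightarrow> bool" where
  "two_sided_ideal scl mul I \<longleftrightarrow>
     module.subspace scl I \<and> (\<forall>a. \<forall>x\<in>I. mul a x \<in> I \<and> mul x a \<in> I)"

definition generated_ideal ::
  "(complex \<Rightarrow> 'a \<Rightarrow> 'a) \<Rightarrow> ('a \<Rightarrow> 'a \<Rightarrow> 'a) \<Rightarrow> 'a::ab_group_add set \<Rightarrow> 'a set" where
  "generated_ideal scl mul R = \<Inter>{I. two_sided_ideal scl mul I \<and> R \<subseteq> I}"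

text \<open>Left actions by linear operators; the right factor of a product acts first.\<close>

definition algebra_action ::
  "(complex \<Rightarrow> 'm \<Rightarrow> 'm) \<Rightarrow> ('a::complex_algebra \<Rightarrow> 'm \<Rightarrow> 'm::ab_group_add) \<Rightarrow> bool" where
  "algebra_action smul \<rho> \<longleftrightarrow>
     (\<forall>x. Vector_Spaces.linear smul smul (\<rho> x)) \<and>
     (\<forall>x y v. \<rho> (x + y) v = \<rho> x v + \<rho> y v) \<and>
     (\<forall>c x v. \<rho> (c *\<^sub>C x) v = smul c (\<rho> x v)) \<and>
     (\<forall>x y v. \<rho> (x * y) v = \<rho> x (\<rho> y v))"

text \<open>Finitely supported families of coefficients form the free vector space on \<open>'a\<close>.\<close>

definition coeff_scale :: "complex \<Rightarrow> ('a \<Rightarrow>\<^sub>0 complex) \<Rightarrow> ('a \<Rightarrow>\<^sub>0 complex)" where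
  "coeff_scale c x = Poly_Mapping.map ((*) c) x"

lemma lookup_coeff_scale [simp]:
  "Poly_Mapping.lookup (coeff_scale c x) k = c * Poly_Mapping.lookup x k"
  by (simp add: coeff_scale_def map.rep_eq when_def)

lemma vector_space_coeff_scale: "vector_space coeff_scale"
  by standard (auto intro!: poly_mapping_eqI simp: lookup_add algebra_simps)

lemma coeff_scale_single: "coeff_scale c (Poly_Mapping.single k a) = Poly_Mapping.single k (c * a)"
  by (rule poly_mapping_eqI) (simp add: lookup_single when_def)

lemma generated_ideal_is_ideal: "two_sided_ideal coeff_scale mul (generated_ideal coeff_scale mul R)"
proof -
  interpret vector_space coeff_scale by (rule vector_space_coeff_scale)
  show ?thesis
    unfolding two_sided_ideal_def generated_ideal_def
    by (auto intro!: subspace_Inter)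
qed

lemma
  shows generated_ideal_zero: "0 \<in> generated_ideal coeff_scale mul R"
    and generated_ideal_add: "x \<in> generated_ideal coeff_scale mul R \<Longrightarrow>
      y \<in> generated_ideal coeff_scale mul R \<Longrightarrow> x + y \<in> generated_ideal coeff_scale mul R"
    and generated_ideal_minus: "x \<in> generated_ideal coeff_scale mul R \<Longrightarrow>
      - x \<in> generated_ideal coeff_scale mul R"
    and generated_ideal_diff: "x \<in> generated_ideal coeff_scale mul R \<Longrightarrow>
      y \<in> generated_ideal coeff_scale mul R \<Longrightarrow> x - y \<in> generated_ideal coeff_scale mul R"
    and generated_ideal_scale: "x \<in> generated_ideal coeff_scale mul R \<Longrightarrow>
      coeff_scale c x \<in> generated_ideal coeff_scale mul R"
    and generated_ideal_left: "x \<in> generated_ideal coeff_scale mul R \<Longrightarrow>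
      mul a x \<in> generated_ideal coeff_scale mul R"
    and generated_ideal_right: "x \<in> generated_ideal coeff_scale mul R \<Longrightarrow>
      mul x a \<in> generated_ideal coeff_scale mul R"
proof -
  interpret vector_space coeff_scale by (rule vector_space_coeff_scale)
  note I = generated_ideal_is_ideal[of mul R, unfolded two_sided_ideal_def]
  show "0 \<in> generated_ideal coeff_scale mul R"
    using I subspace_0 by blast
  show "x \<in> generated_ideal coeff_scale mul R \<Longrightarrow>
      y \<in> generated_ideal coeff_scale mul R \<Longrightarrow> x + y \<in> generated_ideal coeff_scale mul R"
    using I subspace_add by blast
  show "x \<in> generated_ideal coeff_scale mul R \<Longrightarrow> - x \<in> generated_ideal coeff_scale mul R"
    using I subspace_neg by blast
  show "x \<in> generated_ideal coeff_scale mul R \<Longrightarrow>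
      y \<in> generated_ideal coeff_scale mul R \<Longrightarrow> x - y \<in> generated_ideal coeff_scale mul R"
    using I subspace_diff by blast
  show "x \<in> generated_ideal coeff_scale mul R \<Longrightarrow>
      coeff_scale c x \<in> generated_ideal coeff_scale mul R"
    using I subspace_scale by blast
  show "x \<in> generated_ideal coeff_scale mul R \<Longrightarrow> mul a x \<in> generated_ideal coeff_scale mul R"
    using I by blast
  show "x \<in> generated_ideal coeff_scale mul R \<Longrightarrow> mul x a \<in> generated_ideal coeff_scale mul R"
    using I by blast
qed

lemma equivp_generated_ideal: "equivp (\<lambda>x y. x - y \<in> generated_ideal coeff_scale mul R)"
proof (rule equivpI)
  show "reflp (\<lambda>x y. x - y \<in> generated_ideal coeff_scale mul R)"
    by (simp add: reflp_def generated_ideal_zero)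
  show "symp (\<lambda>x y. x - y \<in> generated_ideal coeff_scale mul R)"
    unfolding symp_def using generated_ideal_minus by force
  show "transp (\<lambda>x y. x - y \<in> generated_ideal coeff_scale mul R)"
    unfolding transp_def by (metis diff_add_cancel add_diff_eq generated_ideal_add)
qed

lemma generated_ideal_mult_cong:
  fixes mul :: "('a \<Rightarrow>\<^sub>0 complex) \<Rightarrow> ('a \<Rightarrow>\<^sub>0 complex) \<Rightarrow> ('a \<Rightarrow>\<^sub>0 complex)"
  assumes d: "\<And>x y z. mul (x - y) z = mul x z - mul y z" "\<And>x y z. mul z (x - y) = mul z x - mul z y"
    and "x - x' \<in> generated_ideal coeff_scale mul R" "y - y' \<in> generated_ideal coeff_scale mul R"
  shows "mul x y - mul x' y' \<in> generated_ideal coeff_scale mul R"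
proof -
  have "mul x y - mul x' y' = mul (x - x') y + mul x' (y - y')"
    by (simp add: d)
  then show ?thesis
    using assms(3,4) generated_ideal_left[of "y - y'" mul R x'] generated_ideal_right[of "x - x'" mul R y]
    by (metis generated_ideal_add)
qed

lemma
  assumes "x - x' \<in> generated_ideal coeff_scale mul R" "y - y' \<in> generated_ideal coeff_scale mul R"
  shows generated_ideal_add_cong: "(x + y) - (x' + y') \<in> generated_ideal coeff_scale mul R"
    and generated_ideal_diff_cong: "(x - y) - (x' - y') \<in> generated_ideal coeff_scale mul R"
    and generated_ideal_minus_cong: "(- x) - (- x') \<in> generated_ideal coeff_scale mul R"
proof -
  have "(x + y) - (x' + y') = (x - x') + (y - y')" by simp
  then show "(x + y) - (x' + y') \<in> generated_ideal coeff_scale mul R"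
    using assms generated_ideal_add by metis
  have "(x - y) - (x' - y') = (x - x') - (y - y')" by simp
  then show "(x - y) - (x' - y') \<in> generated_ideal coeff_scale mul R"
    using assms generated_ideal_diff by metis
  have "(- x) - (- x') = - (x - x')" by simp
  then show "(- x) - (- x') \<in> generated_ideal coeff_scale mul R"
    using assms(1) generated_ideal_minus by metis
qed

lemma coeff_scale_zero: "coeff_scale c 0 = 0"
  by (rule poly_mapping_eqI) simp

lemma coeff_scale_add: "coeff_scale c (x + y) = coeff_scale c x + coeff_scale c y"
  by (rule poly_mapping_eqI) (simp add: lookup_add algebra_simps)

lemma coeff_scale_diff: "coeff_scale c (x - y) = coeff_scale c x - coeff_scale c y"
  by (rule poly_mapping_eqI) (simp add: lookup_minus algebra_simps)

lemma poly_mapping_sum_singles: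
  "(\<Sum>k\<in>Poly_Mapping.keys x. Poly_Mapping.single k (Poly_Mapping.lookup x k)) =
    (x :: 'a \<Rightarrow>\<^sub>0 complex)"
  by (rule poly_mapping_eqI) (auto simp: lookup_sum lookup_single when_def in_keys_iff)

lemma poly_mapping_additive_induct:
  fixes x :: "'a \<Rightarrow>\<^sub>0 complex"
  assumes "P 0" "\<And>k c. P (Poly_Mapping.single k c)" "\<And>x y. P x \<Longrightarrow> P y \<Longrightarrow> P (x + y)"
  shows "P x"
proof -
  have "P (\<Sum>k\<in>A. Poly_Mapping.single k (Poly_Mapping.lookup x k))" for A
    by (induction A rule: infinite_finite_induct) (simp_all add: assms)
  then show ?thesis
    by (metis poly_mapping_sum_singles)
qed


section \<open>The algebra \<open>\<Lambda>\<close>\<close>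

text \<open>
  At each vertex \<open>n\<close> exactly one arrow of each kind starts, namely \<open>\<sigma>\<^sub>n\<close> to \<open>n + 1\<close> and \<open>\<tau>\<^sub>n\<close> to
  \<open>n - 1\<close>.  So a path is given by its source and the list of kinds of its arrows, and every such
  pair is a path.  The list is in the order of composition of operators: the last entry is the
  arrow starting at the source.  The empty list gives the trivial path at the source.
\<close>

datatype arrow_kind = Sigma_kind | Tau_kind

datatype path = Path (kinds: "arrow_kind list") (source: int)

fun degree_shift :: "arrow_kind \<Rightarrow> int" where
  "degree_shift Sigma_kind = 1"
| "degree_shift Tau_kind = - 1"

definition target :: "path \<Rightarrow> int" where
  "target p = source p + sum_list (map degree_shift (kinds p))"

definition path_term :: "path \<Rightarrow> path \<Rightarrow> complex \<Rightarrow> path \<Rightarrow>\<^sub>0 complex" where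
  "path_term p q c =
     (if source p = target q then Poly_Mapping.single (Path (kinds p @ kinds q) (source q)) c else 0)"

definition path_mult :: "(path \<Rightarrow>\<^sub>0 complex) \<Rightarrow> (path \<Rightarrow>\<^sub>0 complex) \<Rightarrow> (path \<Rightarrow>\<^sub>0 complex)" where
  "path_mult x y = (\<Sum>p\<in>Poly_Mapping.keys x. \<Sum>q\<in>Poly_Mapping.keys y.
     path_term p q (Poly_Mapping.lookup x p * Poly_Mapping.lookup y q))"

lemma path_term_add: "path_term p q (c + d) = path_term p q c + path_term p q d"
  and path_term_zero [simp]: "path_term p q 0 = 0"
  by (simp_all add: path_term_def single_add)

lemma path_mult_superset:
  assumes "finite A" "finite B" "Poly_Mapping.keys x \<subseteq> A" "Poly_Mapping.keys y \<subseteq> B"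
  shows "path_mult x y =
    (\<Sum>p\<in>A. \<Sum>q\<in>B. path_term p q (Poly_Mapping.lookup x p * Poly_Mapping.lookup y q))"
proof -
  have "path_mult x y = (\<Sum>p\<in>Poly_Mapping.keys x. \<Sum>q\<in>B.
      path_term p q (Poly_Mapping.lookup x p * Poly_Mapping.lookup y q))"
    unfolding path_mult_def using assms
    by (intro sum.cong sum.mono_neutral_left) (auto simp: in_keys_iff)
  also have "\<dots> = (\<Sum>p\<in>A. \<Sum>q\<in>B.
      path_term p q (Poly_Mapping.lookup x p * Poly_Mapping.lookup y q))"
    using assms by (intro sum.mono_neutral_left) (auto simp: in_keys_iff)
  finally show ?thesis .
qed

lemma path_mult_add_left: "path_mult (x + y) z = path_mult x z + path_mult y z"
proof -
  let ?A = "Poly_Mapping.keys x \<union> Poly_Mapping.keys y"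
  have "Poly_Mapping.keys (x + y) \<subseteq> ?A" by (rule keys_add)
  then show ?thesis
    by (simp add: path_mult_superset[of ?A "Poly_Mapping.keys z"] lookup_add algebra_simps
        path_term_add sum.distrib)
qed

lemma path_mult_add_right: "path_mult z (x + y) = path_mult z x + path_mult z y"
proof -
  let ?A = "Poly_Mapping.keys x \<union> Poly_Mapping.keys y"
  have "Poly_Mapping.keys (x + y) \<subseteq> ?A" by (rule keys_add)
  then show ?thesis
    by (simp add: path_mult_superset[of "Poly_Mapping.keys z" ?A] lookup_add algebra_simps
        path_term_add sum.distrib)
qed

lemma path_mult_zero [simp]: "path_mult 0 x = 0" "path_mult x 0 = 0"
  by (simp_all add: path_mult_def)

lemma path_mult_diff_left: "path_mult (x - y) z = path_mult x z - path_mult y z"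
  by (metis add_diff_cancel_right' diff_add_cancel path_mult_add_left)

lemma path_mult_diff_right: "path_mult z (x - y) = path_mult z x - path_mult z y"
  by (metis add_diff_cancel_right' diff_add_cancel path_mult_add_right)

lemma path_mult_single:
  "path_mult (Poly_Mapping.single p c) (Poly_Mapping.single q d) = path_term p q (c * d)"
  by (subst path_mult_superset[of "{p}" "{q}"]) auto

lemma path_mult_scale_left: "path_mult (coeff_scale c x) y = coeff_scale c (path_mult x y)"
proof -
  show ?thesis
  proof (induction x rule: poly_mapping_additive_induct)
    case (2 p a)
    show ?case
      by (induction y rule: poly_mapping_additive_induct)
        (simp_all add: path_mult_add_right coeff_scale_add coeff_scale_zero coeff_scale_single path_mult_single
          path_term_def mult.assoc)
  qed (simp_all add: path_mult_add_left coeff_scale_add coeff_scale_zero)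
qed

lemma path_mult_scale_right: "path_mult x (coeff_scale c y) = coeff_scale c (path_mult x y)"
proof -
  show ?thesis
  proof (induction x rule: poly_mapping_additive_induct)
    case (2 p a)
    show ?case
      by (induction y rule: poly_mapping_additive_induct)
        (simp_all add: path_mult_add_right coeff_scale_add coeff_scale_zero coeff_scale_single path_mult_single
          path_term_def mult.left_commute)
  qed (simp_all add: path_mult_add_left coeff_scale_add coeff_scale_zero)
qed

lemma path_mult_assoc: "path_mult (path_mult x y) z = path_mult x (path_mult y z)"
proof (induction x rule: poly_mapping_additive_induct)
  case (2 p a)
  show ?case
  proof (induction y rule: poly_mapping_additive_induct)
    case (2 q b)
    show ?case
    proof (induction z rule: poly_mapping_additive_induct)
      case (2 r c)
      show ?case
        by (auto simp: path_mult_single path_term_def target_def algebra_simps)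
    qed (simp_all add: path_mult_add_right)
  qed (simp_all add: path_mult_add_right path_mult_add_left)
qed (simp_all add: path_mult_add_left)

definition Lambda_relations :: "(path \<Rightarrow>\<^sub>0 complex) set" where
  "Lambda_relations =
     (\<Union>n. {path_mult (Poly_Mapping.single (Path [Sigma_kind] n) 1)
                     (Poly_Mapping.single (Path [Sigma_kind] (n - 1)) 1),
           path_mult (Poly_Mapping.single (Path [Tau_kind] n) 1)
                     (Poly_Mapping.single (Path [Tau_kind] (n + 1)) 1)})"

definition Lambda_ideal :: "(path \<Rightarrow>\<^sub>0 complex) set" where
  "Lambda_ideal = generated_ideal coeff_scale path_mult Lambda_relations"

quotient_type Lambda = "path \<Rightarrow>\<^sub>0 complex" / "\<lambda>x y. x - y \<in> Lambda_ideal"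
  unfolding Lambda_ideal_def by (rule equivp_generated_ideal)

instantiation Lambda :: complex_algebra
begin

lift_definition zero_Lambda :: Lambda is 0 .

lift_definition plus_Lambda :: "Lambda \<Rightarrow> Lambda \<Rightarrow> Lambda" is "(+)"
  unfolding Lambda_ideal_def by (rule generated_ideal_add_cong)

lift_definition uminus_Lambda :: "Lambda \<Rightarrow> Lambda" is uminus
  unfolding Lambda_ideal_def by (rule generated_ideal_minus_cong)

lift_definition minus_Lambda :: "Lambda \<Rightarrow> Lambda \<Rightarrow> Lambda" is "(-)"
  unfolding Lambda_ideal_def by (rule generated_ideal_diff_cong)

lift_definition times_Lambda :: "Lambda \<Rightarrow> Lambda \<Rightarrow> Lambda" is path_mult
  unfolding Lambda_ideal_def
  by (rule generated_ideal_mult_cong) (auto simp: path_mult_diff_left path_mult_diff_right)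

lift_definition scaleC_Lambda :: "complex \<Rightarrow> Lambda \<Rightarrow> Lambda" is coeff_scale
  unfolding Lambda_ideal_def by (simp add: coeff_scale_diff [symmetric] generated_ideal_scale)

instance
proof
  interpret vector_space "coeff_scale :: complex \<Rightarrow> (path \<Rightarrow>\<^sub>0 complex) \<Rightarrow> _"
    by (rule vector_space_coeff_scale)
  have eqI: "x - y \<in> Lambda_ideal" if "x = y" for x y
    using that by (simp add: Lambda_ideal_def generated_ideal_zero)
  fix a b c :: Lambda and k l :: complex
  show "a + b + c = a + (b + c)" by transfer (rule eqI, simp add: algebra_simps)
  show "a + b = b + a" by transfer (rule eqI, simp)
  show "0 + a = a" by transfer (rule eqI, simp)
  show "- a + a = 0" by transfer (rule eqI, simp)
  show "a - b = a + - b" by transfer (rule eqI, simp)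
  show "a * b * c = a * (b * c)" by transfer (rule eqI, simp add: path_mult_assoc)
  show "(a + b) * c = a * c + b * c" by transfer (rule eqI, simp add: path_mult_add_left)
  show "a * (b + c) = a * b + a * c" by transfer (rule eqI, simp add: path_mult_add_right)
  show "k *\<^sub>C (a + b) = k *\<^sub>C a + k *\<^sub>C b" by transfer (rule eqI, simp add: scale_right_distrib)
  show "(k + l) *\<^sub>C a = k *\<^sub>C a + l *\<^sub>C a" by transfer (rule eqI, simp add: scale_left_distrib)
  show "k *\<^sub>C l *\<^sub>C a = (k * l) *\<^sub>C a" by transfer (rule eqI, simp)
  show "1 *\<^sub>C a = a" by transfer (rule eqI, simp)
  show "(k *\<^sub>C a) * b = k *\<^sub>C (a * b)" by transfer (rule eqI, simp add: path_mult_scale_left)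
  show "a * (k *\<^sub>C b) = k *\<^sub>C (a * b)" by transfer (rule eqI, simp add: path_mult_scale_right)
qed

end

lift_definition e_gen :: "int \<Rightarrow> Lambda" is "\<lambda>n. Poly_Mapping.single (Path [] n) 1" .

lift_definition sigma_gen :: "int \<Rightarrow> Lambda" is "\<lambda>n. Poly_Mapping.single (Path [Sigma_kind] n) 1" .

lift_definition tau_gen :: "int \<Rightarrow> Lambda" is "\<lambda>n. Poly_Mapping.single (Path [Tau_kind] n) 1" .

text \<open>
  \<open>M = \<Oplus>\<^sub>n e\<^sub>n M\<close> as an internal direct sum: every vector is in exactly one way a finite sum of
  vectors \<open>x n \<in> e\<^sub>n M\<close>.
\<close>

definition unitary_action :: "(Lambda \<Rightarrow> 'm \<Rightarrow> 'm::ab_group_add) \<Rightarrow> bool" where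
  "unitary_action act \<longleftrightarrow>
     (\<forall>v. \<exists>!x :: int \<Rightarrow> 'm.
        finite {n. x n \<noteq> 0} \<and> (\<forall>n. x n \<in> range (act (e_gen n))) \<and> v = Sum_any x)"


section \<open>The unrolled quantum group of \<open>sl(2)\<close> at \<open>q = i\<close>\<close>

text \<open>
  Words form the free monoid.  It is written additively because the product of
  \<open>'w \<Rightarrow>\<^sub>0 complex\<close> is the convolution over an additive monoid; so \<open>'g word \<Rightarrow>\<^sub>0 complex\<close> is the
  free unital algebra on \<open>'g\<close>.
\<close>

datatype 'g word = Word (letters: "'g list")

instantiation word :: (type) monoid_add
begin

definition "0 = Word []"

definition "u + v = Word (letters u @ letters v)"

instance
  by standard (simp_all add: zero_word_def plus_word_def)

end

datatype uqh_letter = E_letter | F_letter | H_letter | K_letter | Kinv_letter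

type_synonym uqh_free = "uqh_letter word \<Rightarrow>\<^sub>0 complex"

definition free_gen :: "uqh_letter \<Rightarrow> uqh_free" where
  "free_gen g = Poly_Mapping.single (Word [g]) 1"

text \<open>A relation \<open>l = r\<close> is represented by \<open>l - r\<close>.\<close>

definition UqH_relations :: "uqh_free set" where
  "UqH_relations =
     (let E = free_gen E_letter; F = free_gen F_letter; H = free_gen H_letter;
          K = free_gen K_letter; K' = free_gen Kinv_letter
      in {K * K' - 1, K' * K - 1,
          K * E + E * K, K * F + F * K,
          H * E - E * H - coeff_scale 2 E, H * F - F * H + coeff_scale 2 F,
          E * F - F * E - coeff_scale (1 / (2 * \<i>)) (K - K'),
          E * E, F * F})"

definition UqH_ideal :: "uqh_free set" where
  "UqH_ideal = generated_ideal coeff_scale (*) UqH_relations"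

quotient_type UqH = uqh_free / "\<lambda>x y. x - y \<in> UqH_ideal"
  unfolding UqH_ideal_def by (rule equivp_generated_ideal)

lemma coeff_scale_conv_mult:
  "coeff_scale c x = Poly_Mapping.single 0 c * (x :: 'g word \<Rightarrow>\<^sub>0 complex)"
  unfolding coeff_scale_def by (rule mult_map_scale_conv_mult)

lemma free_mult_scale_left:
  "coeff_scale c x * y = coeff_scale c (x * (y :: 'g word \<Rightarrow>\<^sub>0 complex))"
  by (simp add: coeff_scale_conv_mult mult.assoc)

lemma free_mult_scale_right:
  "x * coeff_scale c y = coeff_scale c (x * (y :: 'g word \<Rightarrow>\<^sub>0 complex))"
proof -
  have "x * Poly_Mapping.single 0 c = Poly_Mapping.single 0 c * x"
    by (induction x rule: poly_mapping_additive_induct)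
      (simp_all add: mult_single algebra_simps)
  then show ?thesis
    by (metis coeff_scale_conv_mult mult.assoc)
qed

instantiation UqH :: "{complex_algebra, monoid_mult}"
begin

lift_definition zero_UqH :: UqH is 0 .

lift_definition one_UqH :: UqH is 1 .

lift_definition plus_UqH :: "UqH \<Rightarrow> UqH \<Rightarrow> UqH" is "(+)"
  unfolding UqH_ideal_def by (rule generated_ideal_add_cong)

lift_definition uminus_UqH :: "UqH \<Rightarrow> UqH" is uminus
  unfolding UqH_ideal_def by (rule generated_ideal_minus_cong)

lift_definition minus_UqH :: "UqH \<Rightarrow> UqH \<Rightarrow> UqH" is "(-)"
  unfolding UqH_ideal_def by (rule generated_ideal_diff_cong)

lift_definition times_UqH :: "UqH \<Rightarrow> UqH \<Rightarrow> UqH" is "(*)"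
  unfolding UqH_ideal_def
  by (rule generated_ideal_mult_cong) (auto simp: algebra_simps)

lift_definition scaleC_UqH :: "complex \<Rightarrow> UqH \<Rightarrow> UqH" is coeff_scale
  unfolding UqH_ideal_def by (simp add: coeff_scale_diff [symmetric] generated_ideal_scale)

instance
proof
  interpret vector_space "coeff_scale :: complex \<Rightarrow> uqh_free \<Rightarrow> _"
    by (rule vector_space_coeff_scale)
  have eqI: "x - y \<in> UqH_ideal" if "x = y" for x y
    using that by (simp add: UqH_ideal_def generated_ideal_zero)
  fix a b c :: UqH and k l :: complex
  show "a + b + c = a + (b + c)" by transfer (rule eqI, simp add: algebra_simps)
  show "a + b = b + a" by transfer (rule eqI, simp)
  show "0 + a = a" by transfer (rule eqI, simp)
  show "- a + a = 0" by transfer (rule eqI, simp)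
  show "a - b = a + - b" by transfer (rule eqI, simp)
  show "a * b * c = a * (b * c)" by transfer (rule eqI, simp add: mult.assoc)
  show "1 * a = a" by transfer (rule eqI, simp)
  show "a * 1 = a" by transfer (rule eqI, simp)
  show "(a + b) * c = a * c + b * c" by transfer (rule eqI, simp add: distrib_right)
  show "a * (b + c) = a * b + a * c" by transfer (rule eqI, simp add: distrib_left)
  show "k *\<^sub>C (a + b) = k *\<^sub>C a + k *\<^sub>C b" by transfer (rule eqI, simp add: scale_right_distrib)
  show "(k + l) *\<^sub>C a = k *\<^sub>C a + l *\<^sub>C a" by transfer (rule eqI, simp add: scale_left_distrib)
  show "k *\<^sub>C l *\<^sub>C a = (k * l) *\<^sub>C a" by transfer (rule eqI, simp)
  show "1 *\<^sub>C a = a" by transfer (rule eqI, simp)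
  show "(k *\<^sub>C a) * b = k *\<^sub>C (a * b)" by transfer (rule eqI, simp add: free_mult_scale_left)
  show "a * (k *\<^sub>C b) = k *\<^sub>C (a * b)" by transfer (rule eqI, simp add: free_mult_scale_right)
qed

end

lift_definition UqH_gen :: "uqh_letter \<Rightarrow> UqH" is free_gen .

definition UqH_action :: "(complex \<Rightarrow> 'm \<Rightarrow> 'm) \<Rightarrow> (UqH \<Rightarrow> 'm \<Rightarrow> 'm::ab_group_add) \<Rightarrow> bool" where
  "UqH_action smul \<rho> \<longleftrightarrow> algebra_action smul \<rho> \<and> \<rho> 1 = id"


section \<open>Power series in an operator\<close>

text \<open>
  Convergence of a series of vectors is tested against all linear functionals.  On a
  finite-dimensional space this is convergence in its unique Hausdorff vector space topology,
  i.e. convergence of the coordinates in any basis.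
\<close>

definition vector_sums ::
  "(complex \<Rightarrow> 'm \<Rightarrow> 'm) \<Rightarrow> (nat \<Rightarrow> 'm) \<Rightarrow> 'm::ab_group_add \<Rightarrow> bool" where
  "vector_sums smul x s \<longleftrightarrow>
     (\<forall>\<phi>. Vector_Spaces.linear smul (*) \<phi> \<longrightarrow> (\<lambda>k. \<phi> (x k)) sums \<phi> s)"

definition operator_series_sums ::
  "(complex \<Rightarrow> 'm \<Rightarrow> 'm) \<Rightarrow> complex fps \<Rightarrow> ('m \<Rightarrow> 'm) \<Rightarrow> ('m \<Rightarrow> 'm::ab_group_add) \<Rightarrow> bool" where
  "operator_series_sums smul a T S \<longleftrightarrow>
     (\<forall>v. vector_sums smul (\<lambda>k. smul (fps_nth a k) ((T ^^ k) v)) (S v))"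

definition operator_series ::
  "(complex \<Rightarrow> 'm \<Rightarrow> 'm) \<Rightarrow> complex fps \<Rightarrow> ('m \<Rightarrow> 'm) \<Rightarrow> ('m \<Rightarrow> 'm::ab_group_add)" where
  "operator_series smul a T = (THE S. operator_series_sums smul a T S)"

definition operator_exp ::
  "(complex \<Rightarrow> 'm \<Rightarrow> 'm) \<Rightarrow> ('m \<Rightarrow> 'm) \<Rightarrow> ('m \<Rightarrow> 'm::ab_group_add)" where
  "operator_exp smul T = operator_series smul (fps_exp 1) T"

text \<open>\<open>q\<^sup>T = e\<^bsup>\<pi>iT/2\<^esup>\<close> for \<open>q = i\<close>.\<close>

definition q_power ::
  "(complex \<Rightarrow> 'm \<Rightarrow> 'm) \<Rightarrow> ('m \<Rightarrow> 'm) \<Rightarrow> ('m \<Rightarrow> 'm::ab_group_add)" where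
  "q_power smul T = operator_exp smul (\<lambda>v. smul (of_real pi * \<i> / 2) (T v))"


section \<open>The operators on a \<open>\<Lambda>\<close>-module\<close>

text \<open>
  The sums over all integers are finite at each vector of a unitary module; \<^const>\<open>Sum_any\<close> is the
  sum over the nonzero terms.
\<close>

definition sigma_op :: "(Lambda \<Rightarrow> 'm \<Rightarrow> 'm) \<Rightarrow> 'm \<Rightarrow> 'm::ab_group_add" where
  "sigma_op act v = Sum_any (\<lambda>n. act (sigma_gen n) v)"

definition tau_op :: "(Lambda \<Rightarrow> 'm \<Rightarrow> 'm) \<Rightarrow> 'm \<Rightarrow> 'm::ab_group_add" where
  "tau_op act v = Sum_any (\<lambda>n. act (tau_gen n) v)"

definition L_op :: "(Lambda \<Rightarrow> 'm \<Rightarrow> 'm) \<Rightarrow> 'm \<Rightarrow> 'm::ab_group_add" where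
  "L_op act v = sigma_op act (tau_op act v) + tau_op act (sigma_op act v)"

definition H_op ::
  "(complex \<Rightarrow> 'm \<Rightarrow> 'm) \<Rightarrow> (Lambda \<Rightarrow> 'm \<Rightarrow> 'm) \<Rightarrow> 'm \<Rightarrow> 'm::ab_group_add" where
  "H_op smul act v = Sum_any (\<lambda>n. smul (of_int (2 * n)) (act (e_gen n) v)) + L_op act v"

definition K_op ::
  "(complex \<Rightarrow> 'm \<Rightarrow> 'm) \<Rightarrow> (Lambda \<Rightarrow> 'm \<Rightarrow> 'm) \<Rightarrow> 'm \<Rightarrow> 'm::ab_group_add" where
  "K_op smul act = operator_exp smul (\<lambda>v. smul (of_real pi * \<i> / 2) (H_op smul act v))"

text \<open>The singularity at \<open>0\<close> is removable; the Taylor series is that of the holomorphic extension.\<close>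

definition f_series :: "complex fps" where
  "f_series = fps_expansion (remove_sings (\<lambda>x. (1 - exp (- (of_real pi * \<i> * x))) / x)) 0"

definition F_op ::
  "(complex \<Rightarrow> 'm \<Rightarrow> 'm) \<Rightarrow> (Lambda \<Rightarrow> 'm \<Rightarrow> 'm) \<Rightarrow> 'm \<Rightarrow> 'm::ab_group_add" where
  "F_op smul act v = smul (1 / (2 * \<i>))
     (tau_op act (operator_series smul f_series (L_op act) (K_op smul act v)))"

definition realizes_assignment ::
  "(complex \<Rightarrow> 'm \<Rightarrow> 'm) \<Rightarrow> (Lambda \<Rightarrow> 'm \<Rightarrow> 'm) \<Rightarrow> (UqH \<Rightarrow> 'm \<Rightarrow> 'm::ab_group_add) \<Rightarrow> bool" where
  "realizes_assignment smul act \<rho> \<longleftrightarrow>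
     \<rho> (UqH_gen H_letter) = H_op smul act \<and>
     \<rho> (UqH_gen K_letter) = K_op smul act \<and>
     \<rho> (UqH_gen E_letter) = sigma_op act \<and>
     \<rho> (UqH_gen F_letter) = F_op smul act"

end

theory Submission
  imports Defs
begin

text \<open>
  The vertex grading gives \<open>H\<sigma> = \<sigma>(H + 2)\<close> and \<open>H\<tau> = \<tau>(H - 2)\<close>, since \<open>L\<close> commutes with \<open>\<sigma>\<close>, \<open>\<tau>\<close> and the
  grading operator \<open>D = \<Sum>\<^sub>n 2n e\<^sub>n\<close>; exponentiating, \<open>K\<close> anticommutes with \<open>\<sigma>\<close> and \<open>\<tau>\<close>.  As
  \<open>x f(x) = 1 - e\<^bsup>-\<pi>ix\<^esup>\<close>, the commutator \<open>2i [E, F] = (\<sigma>\<tau> + \<tau>\<sigma>) f(L) K\<close> equals \<open>K - e\<^bsup>-\<pi>iL\<^esup> K\<close>.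
  The eigenvalues of \<open>D\<close> are even, so \<open>e\<^bsup>\<pi>iD\<^esup> = 1\<close> and \<open>K\<^sup>2 = e\<^bsup>\<pi>iH\<^esup> = e\<^bsup>\<pi>iL\<^esup>\<close>; hence \<open>e\<^bsup>-\<pi>iL\<^esup> K = K\<^sup>-\<^sup>1\<close>.

  The operator \<open>L\<close> need not be nilpotent.  Its power series converge because \<open>f\<close> is entire and
  \<open>\<phi> (T\<^sup>k v)\<close> grows at most geometrically in \<open>k\<close> for every linear functional \<open>\<phi>\<close>.
\<close>

section \<open>The series \<open>f\<close>\<close>

text \<open>The formal quotient is entire and its sum agrees with (1 - exp(-\<pi>ix))/x off 0.
  Continuity of that sum at 0 gives the value of \<open>remove_sings\<close> there.\<close>

lemma f_series_eq: "f_series = fps_shift 1 (1 - fps_exp (- (of_real pi * \<i>)))"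
proof -
  define h :: "complex fps" where "h = fps_shift 1 (1 - fps_exp (- (of_real pi * \<i>)))"
  define g where "g = (\<lambda>x::complex. (1 - exp (- (of_real pi * \<i> * x))) / x)"
  have r1: "fps_conv_radius (1 - fps_exp (- (of_real pi * \<i>)) :: complex fps) = \<infinity>"
    using fps_conv_radius_diff[of 1 "fps_exp (- (of_real pi * \<i>)) :: complex fps"] by simp
  then have r: "fps_conv_radius h = \<infinity>"
    by (simp add: h_def)
  \<comment> \<open>The constant term vanishes, so \<open>fps_shift 1\<close> is a genuine division
    by x. The coefficient at 1 shows that the series is nonzero.\<close>
  have "1 \<le> subdegree (1 - fps_exp (- (of_real pi * \<i>)) :: complex fps)"
    by (intro subdegree_geI) (auto simp: fps_eq_iff intro!: exI[of _ "1::nat"])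
  then have g: "eval_fps h z = g z" if "z \<noteq> 0" for z
    using that r1 by (simp add: h_def g_def eval_fps_shift eval_fps_diff)
  have "remove_sings g z = eval_fps h z" for z
  proof (cases "z = 0")
    case True
    have "isCont (eval_fps h) 0"
      using continuous_eval_fps[of 0 h UNIV] r by simp
    then have "(eval_fps h \<longlongrightarrow> eval_fps h 0) (at 0)"
      by (simp add: isCont_def)
    moreover have "(eval_fps h \<longlongrightarrow> eval_fps h 0) (at 0) \<longleftrightarrow> (g \<longlongrightarrow> eval_fps h 0) (at 0)"
      by (intro filterlim_cong refl) (auto simp: eventually_at_filter g)
    ultimately show ?thesis
      using True by (auto intro: remove_sings_eqI)
  next
    case False
    have "g analytic_on {z}"
      unfolding g_def using False by (intro analytic_intros) auto
    then show ?thesis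
      using False g by simp
  qed
  then have "remove_sings g = eval_fps h"
    by auto
  moreover have "fps_expansion (eval_fps h) 0 = h"
    using r by (intro fps_expansion_eqI eval_fps_has_fps_expansion) simp
  ultimately show ?thesis
    by (simp add: f_series_def g_def h_def)
qed

lemma f_series_conv_radius: "fps_conv_radius f_series = \<infinity>"
  using fps_conv_radius_diff[of 1 "fps_exp (- (of_real pi * \<i>)) :: complex fps"]
  by (simp add: f_series_eq)

lemma fps_X_mult_f_series: "fps_X * f_series = 1 - fps_exp (- (of_real pi * \<i>))"
  by (rule fps_ext) (simp add: f_series_eq fps_X_mult_nth)

section \<open>Entire power series of an operator\<close>

locale complex_vector_space = vector_space smul
  for smul :: "complex \<Rightarrow> 'm::ab_group_add \<Rightarrow> 'm"
begin

abbreviation endo :: "('m \<Rightarrow> 'm) \<Rightarrow> bool" where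
  "endo \<equiv> Vector_Spaces.linear smul smul"

abbreviation functional :: "('m \<Rightarrow> complex) \<Rightarrow> bool" where
  "functional \<equiv> Vector_Spaces.linear smul (*)"

lemma vector_space_complex: "vector_space ((*) :: complex \<Rightarrow> complex \<Rightarrow> complex)"
  by standard (simp_all add: algebra_simps)

lemma endoI:
  assumes "\<And>x y. T (x + y) = T x + T y" "\<And>c x. T (smul c x) = smul c (T x)"
  shows "endo T"
  using assms vector_space_axioms by (simp add: Vector_Spaces.linear_iff)

lemma functionalI:
  assumes "\<And>x y. \<phi> (x + y) = \<phi> x + \<phi> y" "\<And>c x. \<phi> (smul c x) = c * \<phi> x"
  shows "functional \<phi>"
  using assms vector_space_axioms vector_space_complex by (simp add: Vector_Spaces.linear_iff)

lemma
  assumes "endo T"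
  shows endo_add: "T (x + y) = T x + T y"
    and endo_smul: "T (smul c x) = smul c (T x)"
    and endo_zero: "T 0 = 0"
    and endo_minus: "T (- x) = - T x"
    and endo_diff: "T (x - y) = T x - T y"
    and endo_sum: "T (sum g A) = (\<Sum>a\<in>A. T (g a))"
proof -
  interpret T: Vector_Spaces.linear smul smul T by fact
  show "T (x + y) = T x + T y" "T (smul c x) = smul c (T x)" "T 0 = 0" "T (- x) = - T x"
    "T (x - y) = T x - T y" "T (sum g A) = (\<Sum>a\<in>A. T (g a))"
    by (simp_all add: T.add T.scale T.zero T.neg T.diff T.sum)
qed

lemma
  assumes "functional \<phi>"
  shows functional_add: "\<phi> (x + y) = \<phi> x + \<phi> y"
    and functional_smul: "\<phi> (smul c x) = c * \<phi> x"
    and functional_sum: "\<phi> (sum g A) = (\<Sum>a\<in>A. \<phi> (g a))"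
proof -
  interpret \<phi>: Vector_Spaces.linear smul "(*)" \<phi> by fact
  show "\<phi> (x + y) = \<phi> x + \<phi> y" "\<phi> (smul c x) = c * \<phi> x" "\<phi> (sum g A) = (\<Sum>a\<in>A. \<phi> (g a))"
    by (simp_all add: \<phi>.add \<phi>.scale \<phi>.sum)
qed

lemmas endo_linearity = endo_add endo_smul endo_zero endo_minus endo_diff

lemma endo_id: "endo (\<lambda>v. v)" and endo_const_smul: "endo T \<Longrightarrow> endo (\<lambda>v. smul c (T v))"
  by (auto intro!: endoI simp: endo_add endo_smul scale_right_distrib mult.commute)

lemma endo_plus: "endo T \<Longrightarrow> endo U \<Longrightarrow> endo (\<lambda>v. T v + U v)"
  by (auto intro!: endoI simp: endo_add endo_smul scale_right_distrib)

lemma endo_comp: "endo T \<Longrightarrow> endo U \<Longrightarrow> endo (\<lambda>v. T (U v))"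
  by (auto intro!: endoI simp: endo_add endo_smul)

lemma endo_funpow: "endo T \<Longrightarrow> endo (T ^^ k)"
  by (induction k) (auto intro!: endoI simp: endo_add endo_smul)

lemma functional_comp: "functional \<phi> \<Longrightarrow> endo T \<Longrightarrow> functional (\<lambda>v. \<phi> (T v))"
  by (auto intro!: functionalI simp: endo_add endo_smul functional_add functional_smul)

end

locale fd_complex_space = complex_vector_space smul + finite_dimensional_vector_space smul Basis
  for smul :: "complex \<Rightarrow> 'm::ab_group_add \<Rightarrow> 'm" and Basis :: "'m set"
begin

abbreviation coord :: "'m \<Rightarrow> 'm \<Rightarrow> complex" where
  "coord b v \<equiv> representation Basis v b"

abbreviation entire_fps :: "complex fps \<Rightarrow> bool" where
  "entire_fps a \<equiv> fps_conv_radius a = \<infinity>"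

abbreviation ser :: "complex fps \<Rightarrow> ('m \<Rightarrow> 'm) \<Rightarrow> 'm \<Rightarrow> 'm" where
  "ser \<equiv> operator_series smul"

section \<open>Coordinates and linear functionals\<close>

lemma functional_coord: "functional (coord b)"
  by (intro functionalI) (simp_all add: representation_add representation_scale
      independent_Basis span_Basis)

lemma coord_expansion: "(\<Sum>b\<in>Basis. smul (coord b v) b) = v"
  by (rule sum_representation_eq) (simp_all add: independent_Basis span_Basis finite_Basis)

lemma functional_expansion:
  assumes "functional \<phi>"
  shows "\<phi> v = (\<Sum>b\<in>Basis. coord b v * \<phi> b)"
  using arg_cong[OF coord_expansion[of v], of \<phi>] assms
  by (simp add: functional_sum functional_smul)

text \<open>Coordinates are functionals. Since \<open>vector_sums\<close> is tested on functionals,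
  this makes sums of vector series unique.\<close>

lemma functionals_separate:
  assumes "\<And>\<phi>. functional \<phi> \<Longrightarrow> \<phi> x = \<phi> y"
  shows "x = y"
proof -
  have "(\<Sum>b\<in>Basis. smul (coord b x) b) = (\<Sum>b\<in>Basis. smul (coord b y) b)"
    using assms[OF functional_coord] by simp
  then show ?thesis
    unfolding coord_expansion .
qed

lemma power_bound:
  assumes T: "endo T" and \<phi>: "functional \<phi>"
  shows "\<exists>C R. \<forall>k. norm (\<phi> ((T ^^ k) v)) \<le> C * R ^ k"
proof -
  \<comment> \<open>\<open>N\<close> is the l1 norm in the basis; \<open>R\<close> adds the absolute
    values of all matrix entries of \<open>T\<close> and so bounds its operator norm.\<close>
  define N where "N v = (\<Sum>b\<in>Basis. norm (coord b v))" for v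
  define R where "R = (\<Sum>b\<in>Basis. N (T b))"
  have bound: "norm (\<psi> v) \<le> (\<Sum>b\<in>Basis. norm (\<psi> b)) * N v" if "functional \<psi>" for \<psi> v
  proof -
    have "norm (\<psi> v) \<le> (\<Sum>b\<in>Basis. norm (coord b v) * norm (\<psi> b))"
      unfolding functional_expansion[OF that, of v]
      by (rule order_trans[OF norm_sum]) (simp add: norm_mult)
    also have "\<dots> \<le> (\<Sum>b\<in>Basis. N v * norm (\<psi> b))"
      unfolding N_def using finite_Basis
      by (intro sum_mono mult_right_mono member_le_sum) auto
    finally show ?thesis
      by (simp add: sum_distrib_left mult.commute)
  qed
  have "R \<ge> 0" "\<And>v. N v \<ge> 0"
    by (simp_all add: R_def N_def sum_nonneg)
  have step: "N (T v) \<le> R * N v" for v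
  proof -
    have "N (T v) \<le> (\<Sum>c\<in>Basis. (\<Sum>b\<in>Basis. norm (coord c (T b))) * N v)"
      unfolding N_def[of "T v"]
      by (intro sum_mono bound[OF functional_comp[OF functional_coord T]])
    also have "\<dots> = R * N v"
      unfolding sum_distrib_right[symmetric] R_def N_def by (subst sum.swap) simp
    finally show ?thesis .
  qed
  have pow: "N ((T ^^ k) v) \<le> R ^ k * N v" for k
  proof (induction k)
    case (Suc k)
    have "N ((T ^^ Suc k) v) \<le> R * N ((T ^^ k) v)"
      by (simp add: step)
    also have "\<dots> \<le> R * (R ^ k * N v)"
      using Suc \<open>R \<ge> 0\<close> by (intro mult_left_mono)
    finally show ?case
      by (simp add: mult.assoc)
  qed simp
  have "norm (\<phi> ((T ^^ k) v)) \<le> ((\<Sum>b\<in>Basis. norm (\<phi> b)) * N v) * R ^ k" for k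
    using bound[OF \<phi>, of "(T ^^ k) v"] mult_left_mono[OF pow[of k], of "\<Sum>b\<in>Basis. norm (\<phi> b)"]
    by (simp add: sum_nonneg mult.assoc mult.commute[of "N v"])
  then show ?thesis
    by blast
qed

text \<open>An entire series converges absolutely at every radius, in particular at the geometric
  rate of \<open>power_bound\<close>.\<close>

lemma summable_norm_series:
  assumes "endo T" "functional \<phi>" "entire_fps a"
  shows "summable (\<lambda>k. norm (fps_nth a k * \<phi> ((T ^^ k) v)))"
proof -
  obtain C R where CR: "\<And>k. norm (\<phi> ((T ^^ k) v)) \<le> C * R ^ k"
    using power_bound[OF assms(1,2)] by blast
  \<comment> \<open>\<open>power_bound\<close> says nothing about the signs of \<open>C\<close> and
    \<open>R\<close>, so absolute values are taken.\<close>
  have "summable (\<lambda>k. \<bar>C\<bar> * norm (fps_nth a k * of_real R ^ k))"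
    using norm_summable_fps[of "of_real R" a] assms(3) by (intro summable_mult) simp
  then show ?thesis
  proof (rule summable_norm_comparison_test[rotated], intro exI[of _ 0] allI impI)
    fix k
    have "norm (\<phi> ((T ^^ k) v)) \<le> \<bar>C\<bar> * \<bar>R\<bar> ^ k"
      using CR[of k] abs_ge_self[of "C * R ^ k"] by (simp add: abs_mult power_abs)
    from mult_left_mono[OF this, of "norm (fps_nth a k)"]
    show "norm (fps_nth a k * \<phi> ((T ^^ k) v)) \<le> \<bar>C\<bar> * norm (fps_nth a k * of_real R ^ k)"
      by (simp add: norm_mult norm_power algebra_simps)
  qed
qed

section \<open>Existence, uniqueness and linearity of the sum of an operator series\<close>

lemma operator_series_sumsD:
  assumes "operator_series_sums smul a T S" "functional \<phi>"
  shows "(\<lambda>k. fps_nth a k * \<phi> ((T ^^ k) v)) sums \<phi> (S v)"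
  using assms by (simp add: operator_series_sums_def vector_sums_def functional_smul)

lemma operator_series_unique:
  assumes "operator_series_sums smul a T S" "operator_series_sums smul a T S'"
  shows "S = S'"
proof
  fix v
  show "S v = S' v"
  proof (rule functionals_separate)
    fix \<phi> assume \<phi>: "functional \<phi>"
    show "\<phi> (S v) = \<phi> (S' v)"
      by (rule sums_unique2[OF operator_series_sumsD[OF assms(1) \<phi>] operator_series_sumsD[OF assms(2) \<phi>]])
  qed
qed

lemma ser_eqI:
  assumes "operator_series_sums smul a T S"
  shows "ser a T = S"
  unfolding operator_series_def
  by (rule the_equality[where P = "operator_series_sums smul a T"])
    (simp_all add: assms operator_series_unique[OF _ assms])

lemma operator_series_sums:
  assumes T: "endo T" and a: "entire_fps a"
  shows "operator_series_sums smul a T (ser a T)"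
proof -
  \<comment> \<open>The candidate is assembled coordinate by coordinate. An arbitrary functional is
    a finite combination of coordinates, so convergence carries over to it.\<close>
  define S where "S = (\<lambda>v. \<Sum>b\<in>Basis. smul (suminf (\<lambda>k. fps_nth a k * coord b ((T ^^ k) v))) b)"
  have "operator_series_sums smul a T S"
    unfolding operator_series_sums_def vector_sums_def
  proof (intro allI impI)
    fix v \<phi> assume \<phi>: "functional \<phi>"
    have "(\<lambda>k. fps_nth a k * coord b ((T ^^ k) v)) sums (suminf (\<lambda>k. fps_nth a k * coord b ((T ^^ k) v)))"
      for b
      by (rule summable_sums[OF summable_norm_cancel[OF summable_norm_series[OF T functional_coord a]]])
    then have "(\<lambda>k. \<Sum>b\<in>Basis. fps_nth a k * coord b ((T ^^ k) v) * \<phi> b) sums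
        (\<Sum>b\<in>Basis. (suminf (\<lambda>k. fps_nth a k * coord b ((T ^^ k) v))) * \<phi> b)"
      by (intro sums_sum sums_mult2)
    then show "(\<lambda>k. \<phi> (smul (fps_nth a k) ((T ^^ k) v))) sums \<phi> (S v)"
      by (simp add: S_def functional_sum[OF \<phi>] functional_smul[OF \<phi>]
          functional_expansion[OF \<phi>, of "(T ^^ _) v"] sum_distrib_left mult.assoc)
  qed
  then show ?thesis
    using ser_eqI by metis
qed

lemma functional_ser_sums:
  assumes "endo T" "entire_fps a" "functional \<phi>"
  shows "(\<lambda>k. fps_nth a k * \<phi> ((T ^^ k) v)) sums \<phi> (ser a T v)"
  by (rule operator_series_sumsD[OF operator_series_sums[OF assms(1,2)] assms(3)])

lemma ser_apply_eqI:
  assumes "endo T" "entire_fps a"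
    and "\<And>\<phi>. functional \<phi> \<Longrightarrow> (\<lambda>k. fps_nth a k * \<phi> ((T ^^ k) v)) sums \<phi> w"
  shows "ser a T v = w"
proof (rule functionals_separate)
  fix \<phi> assume \<phi>: "functional \<phi>"
  show "\<phi> (ser a T v) = \<phi> w"
    by (rule sums_unique2[OF functional_ser_sums[OF assms(1,2) \<phi>] assms(3)[OF \<phi>]])
qed

text \<open>Induction gives \<open>A\<close> T^k = U^k \<open>A\<close>. As \<phi> composed with
  \<open>A\<close> is again a functional, both sides are sums of the same scalar series.\<close>

lemma ser_intertwine:
  assumes A: "endo A" and T: "endo T" and U: "endo U" and a: "entire_fps a"
    and comm: "\<And>v. A (T v) = U (A v)"
  shows "A (ser a T v) = ser a U (A v)"
proof -
  have "A ((T ^^ k) v) = (U ^^ k) (A v)" for k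
    by (induction k) (simp_all add: comm)
  then show ?thesis
    using functional_ser_sums[OF T a functional_comp[OF _ A], of _ v]
    by (intro ser_apply_eqI[OF U a, symmetric]) simp
qed

lemma ser_commute:
  assumes A: "endo A" and T: "endo T" and a: "entire_fps a" and comm: "\<And>v. A (T v) = T (A v)"
  shows "A (ser a T v) = ser a T (A v)"
  using A T T a comm by (rule ser_intertwine)

lemma endo_ser:
  assumes T: "endo T" and a: "entire_fps a"
  shows "endo (ser a T)"
proof (rule endoI)
  note pw = endo_add[OF endo_funpow[OF T]] endo_smul[OF endo_funpow[OF T]]
  fix x y c
  show "ser a T (x + y) = ser a T x + ser a T y"
    using sums_add[OF functional_ser_sums[OF T a, of _ x] functional_ser_sums[OF T a, of _ y]]
    by (intro ser_apply_eqI[OF T a]) (simp add: functional_add pw distrib_left)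
  show "ser a T (smul c x) = smul c (ser a T x)"
    using sums_mult[OF functional_ser_sums[OF T a, of _ x], of _ c]
    by (intro ser_apply_eqI[OF T a]) (simp add: functional_smul pw mult.left_commute)
qed

section \<open>Products of operator series\<close>

lemma functional_ser_ser_sums:
  assumes S: "endo S" and T: "endo T" and a: "entire_fps a" and b: "entire_fps b"
    and \<phi>: "functional \<phi>"
  shows "(\<lambda>k. \<Sum>i\<le>k. fps_nth a i * fps_nth b (k - i) * \<phi> ((S ^^ i) ((T ^^ (k - i)) v)))
    sums \<phi> (ser a S (ser b T v))"
proof -
  \<comment> \<open>Expanding \<open>T\<^sup>j v\<close> in the basis turns the series into finitely many scalar Cauchy products.\<close>
  define x where "x = (\<lambda>c k. fps_nth a k * \<phi> ((S ^^ k) c))"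
  define y where "y = (\<lambda>c k. fps_nth b k * coord c ((T ^^ k) v))"
  have "(\<lambda>k. \<Sum>i\<le>k. x c i * y c (k - i)) sums (\<phi> (ser a S c) * coord c (ser b T v))" for c
    using Cauchy_product_sums[of "x c" "y c"]
      summable_norm_series[OF S \<phi> a, of c] summable_norm_series[OF T functional_coord[of c] b, of v]
      functional_ser_sums[OF S a \<phi>, of c] functional_ser_sums[OF T b functional_coord[of c], of v]
    by (simp add: x_def y_def sums_iff)
  then have *: "(\<lambda>k. \<Sum>c\<in>Basis. \<Sum>i\<le>k. x c i * y c (k - i)) sums
      (\<Sum>c\<in>Basis. \<phi> (ser a S c) * coord c (ser b T v))"
    by (rule sums_sum)
  have 1: "(\<Sum>c\<in>Basis. \<phi> (ser a S c) * coord c (ser b T v)) = \<phi> (ser a S (ser b T v))"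
    using functional_expansion[OF functional_comp[OF \<phi> endo_ser[OF S a]], of "ser b T v"]
    by (simp add: mult.commute)
  \<comment> \<open>Summing over the basis reassembles T^(k-i) \<open>v\<close> inside the
    functional \<phi> composed with S^i.\<close>
  have "(\<Sum>c\<in>Basis. \<Sum>i\<le>k. x c i * y c (k - i)) =
      (\<Sum>i\<le>k. fps_nth a i * fps_nth b (k - i) * \<phi> ((S ^^ i) ((T ^^ (k - i)) v)))" for k
    by (subst sum.swap, intro sum.cong refl)
      (simp add: x_def y_def functional_expansion[OF functional_comp[OF \<phi> endo_funpow[OF S]],
          of _ "(T ^^ _) v"] sum_distrib_left mult_ac)
  then show ?thesis
    using * 1 by simp
qed

lemma entire_mult: "entire_fps a \<Longrightarrow> entire_fps b \<Longrightarrow> entire_fps (a * b)"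
  using fps_conv_radius_mult[of a b] by simp

lemma ser_mult:
  assumes T: "endo T" and a: "entire_fps a" and b: "entire_fps b"
  shows "ser (a * b) T v = ser a T (ser b T v)"
proof (rule ser_apply_eqI[OF T entire_mult[OF a b]])
  fix \<phi> assume "functional \<phi>"
  have "fps_nth (a * b) k * \<phi> ((T ^^ k) v) =
      (\<Sum>i\<le>k. fps_nth a i * fps_nth b (k - i) * \<phi> ((T ^^ i) ((T ^^ (k - i)) v)))" for k
    unfolding fps_mult_nth sum_distrib_right atLeast0AtMost
    by (intro sum.cong refl) (simp flip: funpow_add comp_apply[of "T ^^ _"])
  then show "(\<lambda>k. fps_nth (a * b) k * \<phi> ((T ^^ k) v)) sums \<phi> (ser a T (ser b T v))"
    using functional_ser_ser_sums[OF T T a b \<open>functional \<phi>\<close>] by simp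
qed

lemma ser_diff:
  assumes T: "endo T" and a: "entire_fps a" and b: "entire_fps b"
  shows "ser (a - b) T v = ser a T v - ser b T v"
proof (rule ser_apply_eqI[OF T])
  show "entire_fps (a - b)"
    using fps_conv_radius_diff[of a b] a b by simp
  fix \<phi> assume \<phi>: "functional \<phi>"
  then interpret \<phi>: Vector_Spaces.linear smul "(*)" \<phi> .
  show "(\<lambda>k. fps_nth (a - b) k * \<phi> ((T ^^ k) v)) sums \<phi> (ser a T v - ser b T v)"
    using sums_diff[OF functional_ser_sums[OF T a \<phi>, of v] functional_ser_sums[OF T b \<phi>, of v]]
    by (simp add: \<phi>.diff left_diff_distrib)
qed

lemma ser_one: "endo T \<Longrightarrow> ser 1 T v = v"
  using sums_If_finite_set[of "{0}" "\<lambda>k. \<phi> ((T ^^ k) v)" for \<phi> :: "'m \<Rightarrow> complex"]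
  by (intro ser_apply_eqI) (simp_all add: if_distrib[of "\<lambda>c. c * _"] cong: if_cong)

lemma ser_fps_X: "endo T \<Longrightarrow> ser fps_X T v = T v"
  using sums_If_finite_set[of "{1}" "\<lambda>k. \<phi> ((T ^^ k) v)" for \<phi> :: "'m \<Rightarrow> complex"]
  by (intro ser_apply_eqI) (simp_all add: fps_X_nth if_distrib[of "\<lambda>c. c * _"] cong: if_cong)

section \<open>Exponentials of operators\<close>

lemma funpow_smul: "endo T \<Longrightarrow> ((\<lambda>v. smul c (T v)) ^^ k) v = smul (c ^ k) ((T ^^ k) v)"
  by (induction k) (simp_all add: endo_smul)

text \<open>The factor c^k moves from the powers of the operator to the coefficients. Exponentials
  of multiples of \<open>H\<close> and \<open>L\<close> thus become entire series in
  \<open>H\<close> and \<open>L\<close> themselves.\<close>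

lemma operator_exp_smul:
  assumes T: "endo T"
  shows "operator_exp smul (\<lambda>v. smul c (T v)) = ser (fps_exp c) T"
proof
  fix v
  show "operator_exp smul (\<lambda>v. smul c (T v)) v = ser (fps_exp c) T v"
    unfolding operator_exp_def
    using functional_ser_sums[OF T, of "fps_exp c" _ v]
    by (intro ser_apply_eqI endo_const_smul[OF T])
      (simp_all add: funpow_smul[OF T] functional_smul)
qed

lemma endo_operator_exp: "endo T \<Longrightarrow> endo (operator_exp smul T)"
  unfolding operator_exp_def by (intro endo_ser) auto

lemma operator_exp_eigenvector:
  assumes T: "endo T" and "T v = smul c v"
  shows "operator_exp smul T v = smul (exp c) v"
  unfolding operator_exp_def
proof (rule ser_apply_eqI[OF T])
  fix \<phi> assume \<phi>: "functional \<phi>"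
  have pw: "(T ^^ k) v = smul (c ^ k) v" for k
    by (induction k) (simp_all add: assms endo_smul mult.commute)
  show "(\<lambda>k. fps_nth (fps_exp 1) k * \<phi> ((T ^^ k) v)) sums \<phi> (smul (exp c) v)"
    using sums_mult2[OF exp_converges[of c], of "\<phi> v"]
    by (simp add: pw functional_smul[OF \<phi>] scaleR_conv_of_real field_simps)
qed simp

text \<open>The functional stays arbitrary in the induction: the outermost \<open>S\<close> or
  \<open>T\<close> is absorbed into it before the induction hypothesis is applied.\<close>

lemma binomial_operators:
  assumes S: "endo S" and T: "endo T" and comm: "\<And>v. S (T v) = T (S v)" and \<phi>: "functional \<phi>"
  shows "\<phi> (((\<lambda>v. S v + T v) ^^ k) v) =
    (\<Sum>i\<le>k. of_nat (k choose i) * \<phi> ((S ^^ i) ((T ^^ (k - i)) v)))"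
  using \<phi>
proof (induction k arbitrary: \<phi>)
  case (Suc k)
  have comm': "T ((S ^^ i) w) = (S ^^ i) (T w)" for i w
    by (induction i) (simp_all flip: comm)
  let ?t = "\<lambda>i j. \<phi> ((S ^^ i) ((T ^^ j) v))"
  have "\<phi> (((\<lambda>v. S v + T v) ^^ Suc k) v) =
      (\<Sum>i\<le>k. of_nat (k choose i) * ?t (Suc i) (k - i)) +
      (\<Sum>i\<le>k. of_nat (k choose i) * ?t i (Suc k - i))"
    using Suc.IH[OF functional_comp[OF Suc.prems S]] Suc.IH[OF functional_comp[OF Suc.prems T]]
    by (simp add: functional_add[OF Suc.prems] comm' Suc_diff_le cong: sum.cong_simp)
  \<comment> \<open>The added term \<open>i = Suc k\<close> is zero because
    \<open>k choose Suc k\<close> is 0. Splitting off \<open>i = 0\<close> next aligns the two sums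
    for Pascal's rule.\<close>
  also have "(\<Sum>i\<le>k. of_nat (k choose i) * ?t i (Suc k - i)) =
      (\<Sum>i\<le>Suc k. of_nat (k choose i) * ?t i (Suc k - i))"
    by simp
  also have "\<dots> = ?t 0 (Suc k) + (\<Sum>i\<le>k. of_nat (k choose Suc i) * ?t (Suc i) (k - i))"
    by (subst sum.atMost_Suc_shift) simp
  also have "(\<Sum>i\<le>k. of_nat (k choose i) * ?t (Suc i) (k - i)) + \<dots> =
      (\<Sum>i\<le>Suc k. of_nat (Suc k choose i) * ?t i (Suc k - i))"
    by (subst sum.atMost_Suc_shift) (simp add: sum.distrib distrib_right)
  finally show ?case .
qed simp

text \<open>Dividing the binomial coefficient by k! leaves 1/(i! (k-i)!), so the binomial expansion
  is the Cauchy product of the two exponential series.\<close>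

lemma operator_exp_add:
  assumes S: "endo S" and T: "endo T" and comm: "\<And>v. S (T v) = T (S v)"
  shows "operator_exp smul (\<lambda>v. S v + T v) v = operator_exp smul S (operator_exp smul T v)"
  unfolding operator_exp_def
proof (rule ser_apply_eqI[OF endo_plus[OF S T]])
  fix \<phi> assume \<phi>: "functional \<phi>"
  have "fps_nth (fps_exp 1) k * \<phi> (((\<lambda>v. S v + T v) ^^ k) v) =
      (\<Sum>i\<le>k. fps_nth (fps_exp 1) i * fps_nth (fps_exp 1) (k - i) *
        \<phi> ((S ^^ i) ((T ^^ (k - i)) v)))" for k
    unfolding binomial_operators[OF S T comm \<phi>] sum_distrib_left
    by (intro sum.cong refl) (simp add: binomial_fact)
  then show "(\<lambda>k. fps_nth (fps_exp 1) k * \<phi> (((\<lambda>v. S v + T v) ^^ k) v)) sums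
      \<phi> (ser (fps_exp 1) S (ser (fps_exp 1) T v))"
    using functional_ser_ser_sums[OF S T _ _ \<phi>, of "fps_exp 1" "fps_exp 1" v] by simp
qed simp

text \<open>The hypothesis says \<open>S A = A (S + d)\<close>, so \<open>A\<close> intertwines
  exp(S + d) with exp(S), and the scalar \<open>d\<close> splits off as exp(d).\<close>

lemma operator_exp_shift:
  assumes S: "endo S" and A: "endo A" and SA: "\<And>v. S (A v) = A (S v) + smul d (A v)"
  shows "operator_exp smul S (A v) = smul (exp d) (A (operator_exp smul S v))"
proof -
  have d: "endo (\<lambda>v. smul d v)"
    by (rule endo_const_smul[OF endo_id])
  have "operator_exp smul S (A v) = A (operator_exp smul (\<lambda>v. S v + smul d v) v)"
    unfolding operator_exp_def
    by (rule ser_intertwine[OF A endo_plus[OF S d] S, symmetric])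
      (simp_all add: SA endo_add[OF A] endo_smul[OF A])
  also have "operator_exp smul (\<lambda>v. S v + smul d v) v =
      operator_exp smul S (operator_exp smul (\<lambda>v. smul d v) v)"
    by (rule operator_exp_add[OF S d]) (simp add: endo_smul[OF S])
  also have "operator_exp smul (\<lambda>v. smul d v) v = smul (exp d) v"
    by (rule operator_exp_eigenvector[OF d]) simp
  finally show ?thesis
    by (simp add: endo_smul[OF A] endo_smul[OF endo_operator_exp[OF S]])
qed

end

section \<open>Actions of free algebras and of the unrolled quantum group\<close>

context complex_vector_space
begin

text \<open>With \<open>foldr\<close> the last letter of a word acts first, as in composition of
  operators.\<close>

definition free_action :: "('g \<Rightarrow> 'm \<Rightarrow> 'm) \<Rightarrow> ('g word \<Rightarrow>\<^sub>0 complex) \<Rightarrow> 'm \<Rightarrow> 'm" where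
  "free_action X x v =
     (\<Sum>w\<in>Poly_Mapping.keys x. smul (Poly_Mapping.lookup x w) (foldr X (letters w) v))"

lemma free_action_superset:
  assumes "finite A" "Poly_Mapping.keys x \<subseteq> A"
  shows "free_action X x v = (\<Sum>w\<in>A. smul (Poly_Mapping.lookup x w) (foldr X (letters w) v))"
  unfolding free_action_def using assms
  by (intro sum.mono_neutral_left) (auto simp: in_keys_iff)

lemma free_action_zero [simp]: "free_action X 0 v = 0"
  by (simp add: free_action_def)

lemma free_action_add: "free_action X (x + y) v = free_action X x v + free_action X y v"
proof -
  let ?A = "Poly_Mapping.keys x \<union> Poly_Mapping.keys y"
  have "Poly_Mapping.keys (x + y) \<subseteq> ?A"
    by (rule keys_add)
  then show ?thesis
    by (simp add: free_action_superset[of ?A] lookup_add scale_left_distrib sum.distrib)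
qed

lemma free_action_diff: "free_action X (x - y) v = free_action X x v - free_action X y v"
  by (metis add_diff_cancel_right' diff_add_cancel free_action_add)

lemma free_action_single:
  "free_action X (Poly_Mapping.single w c) v = smul c (foldr X (letters w) v)"
  by (subst free_action_superset[of "{w}"]) auto

lemma free_action_gen: "free_action X (Poly_Mapping.single (Word [g]) 1) v = X g v"
  by (simp add: free_action_single)

lemma free_action_one: "free_action X 1 v = v"
  using free_action_single[of X 0 1 v] unfolding single_one by (simp add: zero_word_def)

lemma free_action_coeff_scale: "free_action X (coeff_scale c x) v = smul c (free_action X x v)"
  by (induction x rule: poly_mapping_additive_induct)
    (simp_all add: free_action_add free_action_single coeff_scale_add coeff_scale_zero
      coeff_scale_single scale_right_distrib)

lemma endo_foldr: "(\<And>g. endo (X g)) \<Longrightarrow> endo (foldr X gs)"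
  by (induction gs) (auto intro!: endoI simp: endo_add endo_smul)

lemma endo_free_action:
  assumes "\<And>g. endo (X g)"
  shows "endo (free_action X x)"
  by (intro endoI)
    (simp_all add: free_action_def endo_add endo_smul endo_foldr assms scale_right_distrib
      sum.distrib scale_sum_right mult.commute)

lemma free_action_mult:
  assumes X: "\<And>g. endo (X g)"
  shows "free_action X (x * y) v = free_action X x (free_action X y v)"
proof (induction x rule: poly_mapping_additive_induct)
  case (2 p a)
  show ?case
  proof (induction y rule: poly_mapping_additive_induct)
    case (2 q b)
    show ?case
      by (simp add: mult_single free_action_single plus_word_def endo_smul endo_foldr X)
  qed (simp_all add: distrib_left free_action_add endo_add endo_zero endo_free_action X)
qed (simp_all add: distrib_right free_action_add)

text \<open>The elements acting as zero form a two-sided ideal containing \<open>R\<close>, hence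
  contain the ideal generated by \<open>R\<close>.\<close>

lemma free_action_generated_ideal:
  assumes X: "\<And>g. endo (X g)" and R: "\<And>r v. r \<in> R \<Longrightarrow> free_action X r v = 0"
    and x: "x \<in> generated_ideal coeff_scale (*) R"
  shows "free_action X x v = 0"
proof -
  interpret coeff: vector_space "coeff_scale :: complex \<Rightarrow> ('a word \<Rightarrow>\<^sub>0 complex) \<Rightarrow> _"
    by (rule vector_space_coeff_scale)
  have "two_sided_ideal coeff_scale (*) {x. \<forall>v. free_action X x v = 0}"
    unfolding two_sided_ideal_def
    by (auto simp: coeff.subspace_def free_action_add free_action_coeff_scale
        free_action_mult X endo_zero endo_free_action)
  then show ?thesis
    using x R unfolding generated_ideal_def by blast
qed

section \<open>Actions of the unrolled quantum group\<close>

lemma algebra_actionD: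
  assumes "algebra_action smul \<rho>"
  shows "endo (\<rho> x)" "\<rho> (x + y) v = \<rho> x v + \<rho> y v" "\<rho> (c *\<^sub>C x) v = smul c (\<rho> x v)"
    "\<rho> (x * y) v = \<rho> x (\<rho> y v)"
  using assms by (simp_all add: algebra_action_def)

lemma algebra_action_zero: "algebra_action smul \<rho> \<Longrightarrow> \<rho> 0 v = 0"
  using algebra_actionD(2)[of \<rho> 0 0 v] by simp

lemma UqH_action_exists:
  assumes X: "\<And>g. endo (X g)" and R: "\<And>r v. r \<in> UqH_relations \<Longrightarrow> free_action X r v = 0"
  shows "\<exists>\<rho>. UqH_action smul \<rho> \<and> (\<forall>g. \<rho> (UqH_gen g) = X g)"
proof (intro exI conjI allI)
  \<comment> \<open>\<open>rep_UqH\<close> picks some representative; the next fact shows that the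
    choice is immaterial, since the ideal acts by zero.\<close>
  define \<rho> where "\<rho> = (\<lambda>a. free_action X (rep_UqH a))"
  have \<rho>: "\<rho> (abs_UqH x) v = free_action X x v" for x v
  proof -
    have "rep_UqH (abs_UqH x) - x \<in> UqH_ideal"
      using Quotient_abs_rep[OF Quotient_UqH] by (metis UqH.abs_eq_iff)
    then show ?thesis
      using free_action_generated_ideal[where R = UqH_relations and x = "rep_UqH (abs_UqH x) - x"]
      by (simp add: X R UqH_ideal_def \<rho>_def free_action_diff)
  qed
  show "UqH_action smul \<rho>"
    unfolding UqH_action_def algebra_action_def
  proof (intro conjI allI ext)
    fix a b :: UqH and c v
    obtain x y where ab: "a = abs_UqH x" "b = abs_UqH y"
      using Quotient_abs_rep[OF Quotient_UqH] by metis
    show "endo (\<rho> a)"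
      unfolding \<rho>_def by (rule endo_free_action[OF X])
    show "\<rho> (a + b) v = \<rho> a v + \<rho> b v" "\<rho> (c *\<^sub>C a) v = smul c (\<rho> a v)"
      "\<rho> (a * b) v = \<rho> a (\<rho> b v)"
      by (simp_all add: ab plus_UqH.abs_eq times_UqH.abs_eq scaleC_UqH.abs_eq \<rho> free_action_add
          free_action_mult[OF X] free_action_coeff_scale)
    show "\<rho> 1 v = id v"
      by (simp add: one_UqH_def \<rho> free_action_one)
  qed
  show "\<rho> (UqH_gen g) = X g" for g
    by (rule ext) (simp add: UqH_gen.abs_eq free_gen_def \<rho> free_action_gen)
qed

text \<open>Pulled back to the free algebra, an action is recovered from the operators of the five
  letters. This yields uniqueness of an action with given generator operators.\<close>

lemma UqH_action_eq_free_action: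
  assumes "UqH_action smul \<rho>"
  shows "\<rho> (abs_UqH x) v = free_action (\<lambda>g. \<rho> (UqH_gen g)) x v"
proof (induction x rule: poly_mapping_additive_induct)
  have \<rho>: "algebra_action smul \<rho>" "\<rho> 1 = id"
    using assms by (simp_all add: UqH_action_def)
  case 1
  then show ?case
    using algebra_action_zero[OF \<rho>(1)] by (simp flip: zero_UqH_def)
next
  have \<rho>: "algebra_action smul \<rho>" "\<rho> 1 = id"
    using assms by (simp_all add: UqH_action_def)
  case (2 w c)
  obtain gs where w: "w = Word gs"
    by (cases w)
  have "\<rho> (abs_UqH (Poly_Mapping.single (Word gs) c)) v =
      smul c (foldr (\<lambda>g. \<rho> (UqH_gen g)) gs v)"
  proof (induction gs)
    case Nil
    have "Poly_Mapping.single (Word []) c = coeff_scale c (1 :: uqh_free)"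
      by (simp add: coeff_scale_single zero_word_def flip: single_one)
    then have "abs_UqH (Poly_Mapping.single (Word []) c) = c *\<^sub>C 1"
      by (simp add: one_UqH_def scaleC_UqH.abs_eq)
    then show ?case
      by (simp add: algebra_actionD(3)[OF \<rho>(1)] \<rho>(2))
  next
    case (Cons g gs)
    have "Poly_Mapping.single (Word (g # gs)) c = free_gen g * Poly_Mapping.single (Word gs) c"
      by (simp add: free_gen_def mult_single plus_word_def)
    then have "abs_UqH (Poly_Mapping.single (Word (g # gs)) c) =
        UqH_gen g * abs_UqH (Poly_Mapping.single (Word gs) c)"
      by (simp add: UqH_gen.abs_eq times_UqH.abs_eq)
    then show ?case
      by (simp add: algebra_actionD(4)[OF \<rho>(1)] Cons endo_smul[OF algebra_actionD(1)[OF \<rho>(1)]])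
  qed
  then show ?case
    by (simp add: w free_action_single)
next
  have \<rho>: "algebra_action smul \<rho>"
    using assms by (simp add: UqH_action_def)
  case (3 x y)
  then show ?case
    by (simp add: free_action_add algebra_actionD(2)[OF \<rho>] flip: plus_UqH.abs_eq)
qed

lemma UqH_action_eqI:
  assumes "UqH_action smul \<rho>" "UqH_action smul \<rho>'" "\<And>g. \<rho> (UqH_gen g) = \<rho>' (UqH_gen g)"
  shows "\<rho> = \<rho>'"
proof (intro ext)
  fix a v
  show "\<rho> a v = \<rho>' a v"
    by (induction a rule: UqH.abs_induct)
      (simp add: UqH_action_eq_free_action[OF assms(1)] UqH_action_eq_free_action[OF assms(2)]
        assms(3))
qed

end

lemma UqH_K_Kinv:
  "UqH_gen K_letter * UqH_gen Kinv_letter = 1" "UqH_gen Kinv_letter * UqH_gen K_letter = 1"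
proof -
  have "r \<in> UqH_ideal" if "r \<in> UqH_relations" for r
    using that unfolding UqH_ideal_def generated_ideal_def by blast
  then show "UqH_gen K_letter * UqH_gen Kinv_letter = 1"
    "UqH_gen Kinv_letter * UqH_gen K_letter = 1"
    by (simp_all add: UqH_gen.abs_eq times_UqH.abs_eq one_UqH_def UqH.abs_eq_iff UqH_relations_def
        Let_def)
qed

text \<open>The assignment does not prescribe the image of \<open>Kinv_letter\<close>. It is
  determined as the two-sided inverse of the image of \<open>K_letter\<close>.\<close>

lemma (in complex_vector_space) UqH_action_Kinv_unique:
  assumes "UqH_action smul \<rho>" "UqH_action smul \<rho>'"
    and "\<rho> (UqH_gen K_letter) = \<rho>' (UqH_gen K_letter)"
  shows "\<rho> (UqH_gen Kinv_letter) = \<rho>' (UqH_gen Kinv_letter)"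
proof
  fix v
  have inv: "\<rho> (UqH_gen K_letter) (\<rho> (UqH_gen Kinv_letter) v) = v"
      "\<rho> (UqH_gen Kinv_letter) (\<rho> (UqH_gen K_letter) v) = v"
    if "UqH_action smul \<rho>" for \<rho> :: "UqH \<Rightarrow> 'm \<Rightarrow> 'm" and v
    using that by (simp_all add: UqH_action_def UqH_K_Kinv flip: algebra_actionD(4))
  have "\<rho> (UqH_gen Kinv_letter) v =
      \<rho>' (UqH_gen Kinv_letter) (\<rho>' (UqH_gen K_letter) (\<rho> (UqH_gen Kinv_letter) v))"
    by (simp only: inv(2)[OF assms(2)])
  then show "\<rho> (UqH_gen Kinv_letter) v = \<rho>' (UqH_gen Kinv_letter) v"
    by (simp only: inv(1)[OF assms(1)] flip: assms(3))
qed

section \<open>Unitary modules\<close>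

lemma e_gen_mult: "e_gen m * e_gen n = (if m = n then e_gen n else 0)"
  by transfer (simp add: path_mult_single path_term_def target_def Lambda_ideal_def generated_ideal_zero)

lemma e_gen_sigma_gen: "e_gen m * sigma_gen n = (if m = n + 1 then sigma_gen n else 0)"
  by transfer (simp add: path_mult_single path_term_def target_def Lambda_ideal_def generated_ideal_zero)

lemma sigma_gen_e_gen: "sigma_gen m * e_gen n = (if m = n then sigma_gen n else 0)"
  by transfer (simp add: path_mult_single path_term_def target_def Lambda_ideal_def generated_ideal_zero)

lemma e_gen_tau_gen: "e_gen m * tau_gen n = (if m = n - 1 then tau_gen n else 0)"
  by transfer (simp add: path_mult_single path_term_def target_def Lambda_ideal_def generated_ideal_zero)

lemma tau_gen_e_gen: "tau_gen m * e_gen n = (if m = n then tau_gen n else 0)"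
  by transfer (simp add: path_mult_single path_term_def target_def Lambda_ideal_def generated_ideal_zero)

lemma Lambda_relations_subset: "r \<in> Lambda_relations \<Longrightarrow> r \<in> Lambda_ideal"
  unfolding Lambda_ideal_def generated_ideal_def by blast

lemma sigma_gen_sigma_gen: "sigma_gen (n + 1) * sigma_gen n = 0"
proof transfer
  fix n
  show "path_mult (Poly_Mapping.single (Path [Sigma_kind] (n + 1)) 1)
      (Poly_Mapping.single (Path [Sigma_kind] n) 1) - 0 \<in> Lambda_ideal"
    \<comment> \<open>The relations are indexed by the source of their left factor, here
      \<open>n + 1\<close>.\<close>
    by (force intro!: Lambda_relations_subset simp: Lambda_relations_def intro: exI[of _ "n + 1"])
qed

lemma tau_gen_tau_gen: "tau_gen (n - 1) * tau_gen n = 0"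
proof transfer
  fix n
  show "path_mult (Poly_Mapping.single (Path [Tau_kind] (n - 1)) 1)
      (Poly_Mapping.single (Path [Tau_kind] n) 1) - 0 \<in> Lambda_ideal"
    \<comment> \<open>Here the source of the left factor is \<open>n - 1\<close>.\<close>
    by (force intro!: Lambda_relations_subset simp: Lambda_relations_def intro: exI[of _ "n - 1"])
qed

locale unitary_Lambda_module = fd_complex_space smul Basis
  for smul :: "complex \<Rightarrow> 'm::ab_group_add \<Rightarrow> 'm" and Basis :: "'m set" +
  fixes act :: "Lambda \<Rightarrow> 'm \<Rightarrow> 'm"
  assumes action: "algebra_action smul act"
    and unitary: "unitary_action act"
begin

lemma endo_act: "endo (act x)"
  by (rule algebra_actionD(1)[OF action])

lemma act_act: "act x (act y v) = act (x * y) v"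
  by (simp add: algebra_actionD(4)[OF action])

lemma act_0: "act 0 v = 0"
  by (rule algebra_action_zero[OF action])

text \<open>As \<open>e_gen n\<close> acts as an idempotent, its fixed vectors are exactly its
  range, the graded piece at vertex n.\<close>

definition homogeneous :: "int \<Rightarrow> 'm \<Rightarrow> bool" where
  "homogeneous n v \<longleftrightarrow> act (e_gen n) v = v"

lemma homogeneous_act_e_gen: "homogeneous n (act (e_gen n) v)"
  by (simp add: homogeneous_def act_act e_gen_mult)

text \<open>The idempotents are orthogonal, so applying \<open>e_gen n\<close> to the decomposition
  of \<open>v\<close> extracts its component \<open>x n\<close>.\<close>

lemma
  shows finite_components: "finite {n. act (e_gen n) v \<noteq> 0}"
    and sum_components: "(\<Sum>n | act (e_gen n) v \<noteq> 0. act (e_gen n) v) = v"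
proof -
  obtain x where fin: "finite {n. x n \<noteq> 0}" and x: "\<And>n. x n \<in> range (act (e_gen n))"
    and v: "v = Sum_any x"
    using unitary unfolding unitary_action_def by metis
  have ex: "act (e_gen n) (x m) = (if n = m then x m else 0)" for n m
  proof -
    obtain w where "x m = act (e_gen m) w"
      using x by blast
    then show ?thesis
      by (simp add: act_act e_gen_mult act_0)
  qed
  have "act (e_gen n) v = x n" for n
  proof -
    have "act (e_gen n) v = (\<Sum>m | x m \<noteq> 0. if n = m then x m else 0)"
      unfolding v Sum_any.expand_set endo_sum[OF endo_act] ex ..
    also have "\<dots> = x n"
      using fin by simp
    finally show ?thesis .
  qed
  then show "finite {n. act (e_gen n) v \<noteq> 0}"
    and "(\<Sum>n | act (e_gen n) v \<noteq> 0. act (e_gen n) v) = v"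
    using fin by (simp_all add: v Sum_any.expand_set)
qed

text \<open>This reduces operator identities to single graded pieces, where the infinite sums have
  one term.\<close>

lemma endo_eq_homogeneous:
  assumes A: "endo A" and B: "endo B" and "\<And>n v. homogeneous n v \<Longrightarrow> A v = B v"
  shows "A v = B v"
proof -
  have "A (\<Sum>n | act (e_gen n) v \<noteq> 0. act (e_gen n) v) =
      B (\<Sum>n | act (e_gen n) v \<noteq> 0. act (e_gen n) v)"
    unfolding endo_sum[OF A] endo_sum[OF B]
    by (intro sum.cong refl assms(3)[OF homogeneous_act_e_gen])
  then show ?thesis
    unfolding sum_components .
qed

context
  fixes A :: "int \<Rightarrow> 'm \<Rightarrow> 'm"
  assumes endo_A: "\<And>n. endo (A n)" and A_e: "\<And>n v. A n (act (e_gen n) v) = A n v"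
begin

text \<open>Each \<open>A n\<close> factors through \<open>e_gen n\<close>, so only finitely many
  terms are nonzero at a given vector. Additivity needs this, as \<open>Sum_any\<close> is 0 on
  infinite support.\<close>

lemma endo_Sum_any: "endo (\<lambda>v. Sum_any (\<lambda>n. A n v))"
proof (rule endoI)
  have fin: "finite {n. A n v \<noteq> 0}" for v
  proof (rule finite_subset[OF _ finite_components])
    show "{n. A n v \<noteq> 0} \<subseteq> {n. act (e_gen n) v \<noteq> 0}"
      using A_e[of _ v] endo_zero[OF endo_A] by (metis (mono_tags, lifting) Collect_mono)
  qed
  show "Sum_any (\<lambda>n. A n (x + y)) = Sum_any (\<lambda>n. A n x) + Sum_any (\<lambda>n. A n y)" for x y
    using Sum_any.distrib[OF fin fin] by (simp add: endo_add[OF endo_A])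
  show "Sum_any (\<lambda>n. A n (smul c x)) = smul c (Sum_any (\<lambda>n. A n x))" for c x
    \<comment> \<open>For nonzero \<open>c\<close> the two supports coincide; for
      \<open>c = 0\<close> both sides vanish.\<close>
    by (cases "c = 0")
      (simp_all add: endo_smul[OF endo_A] endo_zero[OF endo_A] Sum_any.expand_set scale_sum_right)
qed

lemma Sum_any_homogeneous:
  assumes "homogeneous n v"
  shows "Sum_any (\<lambda>m. A m v) = A n v"
proof -
  have "A m v = 0" if "m \<noteq> n" for m
    using A_e[of m v] assms that
    by (metis act_0 act_act e_gen_mult endo_A endo_zero homogeneous_def)
  then show ?thesis
    by (subst Sum_any.expand_superset[of "{n}"]) auto
qed

end

section \<open>The operators of the assignment and their commutation relations\<close>

abbreviation "\<sigma> \<equiv> sigma_op act"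
abbreviation "\<tau> \<equiv> tau_op act"
abbreviation "L \<equiv> L_op act"
abbreviation "H \<equiv> H_op smul act"
abbreviation "K \<equiv> K_op smul act"

definition D :: "'m \<Rightarrow> 'm" where
  "D v = Sum_any (\<lambda>n. smul (of_int (2 * n)) (act (e_gen n) v))"

lemma H_eq: "H v = D v + L v"
  by (simp add: H_op_def D_def)

lemma endo_\<sigma>: "endo \<sigma>"
  using endo_Sum_any[of "\<lambda>n. act (sigma_gen n)"]
  by (simp add: sigma_op_def[abs_def] endo_act act_act sigma_gen_e_gen)

lemma endo_\<tau>: "endo \<tau>"
  using endo_Sum_any[of "\<lambda>n. act (tau_gen n)"]
  by (simp add: tau_op_def[abs_def] endo_act act_act tau_gen_e_gen)

lemma endo_D: "endo D"
  using endo_Sum_any[of "\<lambda>n v. smul (of_int (2 * n)) (act (e_gen n) v)"]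
  by (simp add: D_def[abs_def] endo_const_smul endo_act act_act e_gen_mult)

lemma endo_L: "endo L"
  using endo_plus[OF endo_comp[OF endo_\<sigma> endo_\<tau>] endo_comp[OF endo_\<tau> endo_\<sigma>]]
  by (simp add: L_op_def[abs_def])

lemma endo_H: "endo H"
  using endo_plus[OF endo_D endo_L] by (simp flip: H_eq)

lemma \<sigma>_homogeneous: "homogeneous n v \<Longrightarrow> \<sigma> v = act (sigma_gen n) v"
  using Sum_any_homogeneous[of "\<lambda>n. act (sigma_gen n)"]
  by (simp add: sigma_op_def endo_act act_act sigma_gen_e_gen)

lemma \<tau>_homogeneous: "homogeneous n v \<Longrightarrow> \<tau> v = act (tau_gen n) v"
  using Sum_any_homogeneous[of "\<lambda>n. act (tau_gen n)"]
  by (simp add: tau_op_def endo_act act_act tau_gen_e_gen)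

lemma D_homogeneous: "homogeneous n v \<Longrightarrow> D v = smul (of_int (2 * n)) v"
  using Sum_any_homogeneous[of "\<lambda>n v. smul (of_int (2 * n)) (act (e_gen n) v)"]
  by (simp add: D_def endo_const_smul endo_act act_act e_gen_mult) (simp add: homogeneous_def)

lemma homogeneous_\<sigma>: "homogeneous n v \<Longrightarrow> homogeneous (n + 1) (\<sigma> v)"
  by (simp add: \<sigma>_homogeneous) (simp add: homogeneous_def act_act e_gen_sigma_gen)

lemma homogeneous_\<tau>: "homogeneous n v \<Longrightarrow> homogeneous (n - 1) (\<tau> v)"
  by (simp add: \<tau>_homogeneous) (simp add: homogeneous_def act_act e_gen_tau_gen)

lemma \<sigma>_\<sigma>: "\<sigma> (\<sigma> v) = 0"
proof (rule endo_eq_homogeneous[OF endo_comp[OF endo_\<sigma> endo_\<sigma>], of "\<lambda>_. 0"])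
  show "endo (\<lambda>_. 0)"
    by (rule endoI) simp_all
  fix n v assume v: "homogeneous n v"
  then show "\<sigma> (\<sigma> v) = 0"
    by (simp add: \<sigma>_homogeneous[OF homogeneous_\<sigma>[OF v]])
      (simp add: \<sigma>_homogeneous act_act sigma_gen_sigma_gen act_0)
qed

lemma \<tau>_\<tau>: "\<tau> (\<tau> v) = 0"
proof (rule endo_eq_homogeneous[OF endo_comp[OF endo_\<tau> endo_\<tau>], of "\<lambda>_. 0"])
  show "endo (\<lambda>_. 0)"
    by (rule endoI) simp_all
  fix n v assume v: "homogeneous n v"
  then show "\<tau> (\<tau> v) = 0"
    by (simp add: \<tau>_homogeneous[OF homogeneous_\<tau>[OF v]])
      (simp add: \<tau>_homogeneous act_act tau_gen_tau_gen act_0)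
qed

lemma D_\<sigma>: "D (\<sigma> v) = \<sigma> (D v) + smul 2 (\<sigma> v)"
proof (rule endo_eq_homogeneous[OF endo_comp[OF endo_D endo_\<sigma>]
      endo_plus[OF endo_comp[OF endo_\<sigma> endo_D] endo_const_smul[OF endo_\<sigma>]]])
  fix n v assume v: "homogeneous n v"
  then show "D (\<sigma> v) = \<sigma> (D v) + smul 2 (\<sigma> v)"
    by (simp add: D_homogeneous[OF v] D_homogeneous[OF homogeneous_\<sigma>[OF v]] endo_smul[OF endo_\<sigma>]
        algebra_simps)
qed

lemma D_\<tau>: "D (\<tau> v) = \<tau> (D v) + smul (- 2) (\<tau> v)"
proof (rule endo_eq_homogeneous[OF endo_comp[OF endo_D endo_\<tau>]
      endo_plus[OF endo_comp[OF endo_\<tau> endo_D] endo_const_smul[OF endo_\<tau>]]])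
  fix n v assume v: "homogeneous n v"
  then show "D (\<tau> v) = \<tau> (D v) + smul (- 2) (\<tau> v)"
    by (simp add: D_homogeneous[OF v] D_homogeneous[OF homogeneous_\<tau>[OF v]] endo_smul[OF endo_\<tau>]
        algebra_simps)
qed

text \<open>As \<sigma> squares to zero, both sides reduce to \<sigma>\<tau>\<sigma>.\<close>

lemma L_\<sigma>: "L (\<sigma> v) = \<sigma> (L v)"
  by (simp add: L_op_def \<sigma>_\<sigma> endo_add[OF endo_\<sigma>] endo_zero[OF endo_\<tau>])

lemma L_\<tau>: "L (\<tau> v) = \<tau> (L v)"
  by (simp add: L_op_def \<tau>_\<tau> endo_add[OF endo_\<tau>] endo_zero[OF endo_\<sigma>])

text \<open>The shifts +2 from \<sigma> and -2 from \<tau> cancel in each summand of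
  \<open>L\<close>.\<close>

lemma D_L: "D (L v) = L (D v)"
  by (simp add: L_op_def D_\<sigma> D_\<tau> endo_linearity[OF endo_D] endo_linearity[OF endo_\<sigma>]
      endo_linearity[OF endo_\<tau>])

lemma H_\<sigma>: "H (\<sigma> v) = \<sigma> (H v) + smul 2 (\<sigma> v)"
  by (simp add: H_eq D_\<sigma> L_\<sigma> endo_add[OF endo_\<sigma>])

lemma H_\<tau>: "H (\<tau> v) = \<tau> (H v) + smul (- 2) (\<tau> v)"
  by (simp add: H_eq D_\<tau> L_\<tau> endo_add[OF endo_\<tau>])

lemma H_L: "H (L v) = L (H v)"
  by (simp add: H_eq D_L endo_add[OF endo_L])

lemma endo_cH: "endo (\<lambda>v. smul c (H v))"
  by (rule endo_const_smul[OF endo_H])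

lemma K_eq: "K = ser (fps_exp (of_real pi * \<i> / 2)) H"
  unfolding K_op_def by (rule operator_exp_smul[OF endo_H])

lemma endo_K: "endo K"
  unfolding K_eq by (intro endo_ser[OF endo_H]) simp

lemma K_\<sigma>: "K (\<sigma> v) = - \<sigma> (K v)"
  \<comment> \<open>Scaling \<open>H\<close> by \<pi>i/2 turns the shift 2 into \<pi>i, and
    exp(\<pi>i) = -1.\<close>
  using operator_exp_shift[OF endo_cH endo_\<sigma>, of "of_real pi * \<i> / 2" "of_real pi * \<i>" v]
  by (simp add: K_op_def H_\<sigma> endo_smul[OF endo_\<sigma>] scale_right_distrib exp_pi_i)

lemma K_\<tau>: "K (\<tau> v) = - \<tau> (K v)"
  using operator_exp_shift[OF endo_cH endo_\<tau>, of "of_real pi * \<i> / 2" "- of_real pi * \<i>" v]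
  by (simp add: K_op_def H_\<tau> endo_smul[OF endo_\<tau>] scale_right_diff_distrib exp_minus exp_pi_i)

text \<open>Being a series in \<open>H\<close> like \<open>K\<close>, it is inverse to
  \<open>K\<close> by the product formula for formal exponentials.\<close>

definition Kinv :: "'m \<Rightarrow> 'm" where
  "Kinv = ser (fps_exp (- (of_real pi * \<i> / 2))) H"

lemma endo_Kinv: "endo Kinv"
  unfolding Kinv_def by (intro endo_ser[OF endo_H]) simp

lemma
  shows K_Kinv: "K (Kinv v) = v" and Kinv_K: "Kinv (K v) = v"
  by (simp_all add: K_eq Kinv_def ser_one endo_H flip: ser_mult fps_exp_add_mult)

lemma exp_pi_i_D: "operator_exp smul (\<lambda>v. smul (of_real pi * \<i>) (D v)) v = v"
proof (rule endo_eq_homogeneous[OF endo_operator_exp endo_id])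
  show D': "endo (\<lambda>v. smul (of_real pi * \<i>) (D v))"
    by (rule endo_const_smul[OF endo_D])
  fix n v assume v: "homogeneous n v"
  have "exp (of_real pi * \<i> * of_int (2 * n)) = 1"
    by (simp add: exp_eq_1)
  then show "operator_exp smul (\<lambda>v. smul (of_real pi * \<i>) (D v)) v = v"
    using operator_exp_eigenvector[OF D', of v "of_real pi * \<i> * of_int (2 * n)"]
    by (simp add: D_homogeneous[OF v])
qed

text \<open>\<open>H\<close> and \<open>L\<close> commute, so the exponents add up to
  -\<pi>i\<open>L\<close> + \<pi>i\<open>H\<close> = \<pi>i\<open>D\<close>, whose exponential is
  the identity.\<close>

lemma exp_L_K_K: "ser (fps_exp (- (of_real pi * \<i>))) L (K (K v)) = v"
proof -
  define c :: complex where "c = of_real pi * \<i> / 2"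
  have c2: "2 * c = of_real pi * \<i>"
    by (simp add: c_def)
  have double: "smul (2 * c) w = smul c w + smul c w" for w
    by (metis mult_2 scale_left_distrib)
  have L': "endo (\<lambda>v. smul (- (2 * c)) (L v))"
    by (rule endo_const_smul[OF endo_L])
  have "K (K v) = operator_exp smul (\<lambda>v. smul c (H v) + smul c (H v)) v"
    unfolding K_op_def c_def by (rule operator_exp_add[OF endo_cH endo_cH, symmetric]) simp
  then have "ser (fps_exp (- (of_real pi * \<i>))) L (K (K v)) =
      operator_exp smul (\<lambda>v. smul (- (2 * c)) (L v) + (smul c (H v) + smul c (H v))) v"
    unfolding c2[symmetric] operator_exp_smul[OF endo_L, symmetric]
    by (subst operator_exp_add[OF L' endo_plus[OF endo_cH endo_cH]])
      (simp_all add: endo_linearity[OF endo_L] endo_linearity[OF endo_H] H_L scale_right_distrib mult.commute)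
  also have "(\<lambda>v. smul (- (2 * c)) (L v) + (smul c (H v) + smul c (H v))) =
      (\<lambda>v. smul (of_real pi * \<i>) (D v))"
    unfolding c2[symmetric] by (simp add: H_eq scale_right_distrib double)
  finally show ?thesis
    by (simp add: exp_pi_i_D)
qed

section \<open>The operator f(L)\<close>

abbreviation "fL \<equiv> ser f_series L"

lemma endo_fL: "endo fL"
  by (rule endo_ser[OF endo_L f_series_conv_radius])

lemma fL_\<sigma>: "fL (\<sigma> v) = \<sigma> (fL v)"
  by (rule ser_commute[OF endo_\<sigma> endo_L f_series_conv_radius, symmetric]) (simp add: L_\<sigma>)

lemma fL_\<tau>: "fL (\<tau> v) = \<tau> (fL v)"
  by (rule ser_commute[OF endo_\<tau> endo_L f_series_conv_radius, symmetric]) (simp add: L_\<tau>)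

lemma H_fL: "H (fL v) = fL (H v)"
  by (rule ser_commute[OF endo_H endo_L f_series_conv_radius]) (rule H_L)

lemma K_fL: "K (fL v) = fL (K v)"
  unfolding K_eq by (rule ser_commute[OF endo_fL endo_H, symmetric]) (simp_all add: H_fL)

lemma H_K: "H (K v) = K (H v)"
  unfolding K_eq by (rule ser_commute[OF endo_H endo_H]) simp_all

lemma L_fL_K: "L (fL (K v)) = K v - Kinv v"
proof -
  have "L (fL (K v)) = ser (fps_X * f_series) L (K v)"
    by (simp add: ser_mult endo_L f_series_conv_radius ser_fps_X)
  also have "\<dots> = K v - ser (fps_exp (- (of_real pi * \<i>))) L (K v)"
    by (simp add: fps_X_mult_f_series ser_diff endo_L ser_one)
  \<comment> \<open>Applying \<open>exp_L_K_K\<close> to \<open>Kinv v\<close> cancels one of the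
    two factors \<open>K\<close>.\<close>
  also have "ser (fps_exp (- (of_real pi * \<i>))) L (K v) = Kinv v"
    using exp_L_K_K[of "Kinv v"] by (simp add: K_Kinv)
  finally show ?thesis .
qed

section \<open>The operator F and the defining relations\<close>

abbreviation "F \<equiv> F_op smul act"

lemma F_eq: "F v = smul (1 / (2 * \<i>)) (\<tau> (fL (K v)))"
  by (simp add: F_op_def)

lemma endo_F: "endo F"
  unfolding F_eq[abs_def]
  by (rule endo_const_smul[OF endo_comp[OF endo_\<tau> endo_comp[OF endo_fL endo_K]]])

lemma K_F: "K (F v) = - F (K v)"
  by (simp add: F_eq endo_linearity[OF endo_K] K_\<tau> K_fL)

lemma H_F: "H (F v) = F (H v) + smul (- 2) (F v)"
  by (simp add: F_eq endo_linearity[OF endo_H] H_\<tau> H_fL H_K scale_right_diff_distrib)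

text \<open>Moving \<open>K\<close> and f(L) past the inner \<tau> costs only a sign and leaves
  \<tau> applied twice.\<close>

lemma F_F: "F (F v) = 0"
  by (simp add: F_eq endo_linearity[OF endo_K] endo_linearity[OF endo_fL] endo_linearity[OF endo_\<tau>]
      K_\<tau> fL_\<tau> \<tau>_\<tau>)

text \<open>\<open>K\<close> anticommutes with \<sigma>, which turns the commutator into the
  anticommutator \<sigma>\<tau> + \<tau>\<sigma> = \<open>L\<close> applied to
  f(L)\<open>K\<close>.\<close>

lemma \<sigma>_F: "\<sigma> (F v) - F (\<sigma> v) = smul (1 / (2 * \<i>)) (K v - Kinv v)"
proof -
  have "\<sigma> (F v) - F (\<sigma> v) = smul (1 / (2 * \<i>)) (L (fL (K v)))"
    by (simp add: F_eq L_op_def endo_linearity[OF endo_\<sigma>] K_\<sigma> fL_\<sigma> endo_linearity[OF endo_fL]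
        endo_linearity[OF endo_\<tau>] scale_right_distrib)
  then show ?thesis
    by (simp add: L_fL_K)
qed

fun uqh_op :: "uqh_letter \<Rightarrow> 'm \<Rightarrow> 'm" where
  "uqh_op E_letter = \<sigma>"
| "uqh_op F_letter = F"
| "uqh_op H_letter = H"
| "uqh_op K_letter = K"
| "uqh_op Kinv_letter = Kinv"

lemma endo_uqh_op: "endo (uqh_op g)"
  by (cases g) (simp_all add: endo_\<sigma> endo_F endo_H endo_K endo_Kinv)

lemma uqh_op_relations:
  assumes "r \<in> UqH_relations"
  shows "free_action uqh_op r v = 0"
  using assms
  by (auto simp: UqH_relations_def Let_def free_gen_def free_action_add free_action_diff
      free_action_mult[OF endo_uqh_op] free_action_gen free_action_coeff_scale free_action_one
      K_Kinv Kinv_K K_\<sigma> K_F H_\<sigma> H_F \<sigma>_F \<sigma>_\<sigma> F_F)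

lemma ex1_UqH_action: "\<exists>!\<rho>. UqH_action smul \<rho> \<and> realizes_assignment smul act \<rho>"
proof (rule ex_ex1I)
  show "\<exists>\<rho>. UqH_action smul \<rho> \<and> realizes_assignment smul act \<rho>"
    using UqH_action_exists[OF endo_uqh_op uqh_op_relations]
    by (auto simp: realizes_assignment_def)
next
  fix \<rho> \<rho>'
  assume \<rho>: "UqH_action smul \<rho> \<and> realizes_assignment smul act \<rho>"
    and \<rho>': "UqH_action smul \<rho>' \<and> realizes_assignment smul act \<rho>'"
  show "\<rho> = \<rho>'"
  proof (rule UqH_action_eqI)
    fix g
    show "\<rho> (UqH_gen g) = \<rho>' (UqH_gen g)"
      using \<rho> \<rho>' UqH_action_Kinv_unique[of \<rho> \<rho>']
      by (cases g) (auto simp: realizes_assignment_def)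
  qed (use \<rho> \<rho>' in auto)
qed

end

theorem lemma5p2:
  fixes smul :: "complex \<Rightarrow> 'm::ab_group_add \<Rightarrow> 'm"
    and Basis :: "'m set"
    and act :: "Lambda \<Rightarrow> 'm \<Rightarrow> 'm"
  assumes "finite_dimensional_vector_space smul Basis"
    and "algebra_action smul act"
    and "unitary_action act"
  shows "(\<exists>S. operator_series_sums smul f_series (L_op act) S) \<and>
    (\<exists>S. operator_series_sums smul (fps_exp 1)
           (\<lambda>v. smul (of_real pi * \<i> / 2) (H_op smul act v)) S) \<and>
    (\<exists>!\<rho>. UqH_action smul \<rho> \<and> realizes_assignment smul act \<rho>) \<and>
    (\<forall>\<rho>. UqH_action smul \<rho> \<and> realizes_assignment smul act \<rho> \<longrightarrow>
       \<rho> (UqH_gen K_letter) = q_power smul (\<rho> (UqH_gen H_letter)))"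
proof -
  interpret finite_dimensional_vector_space smul Basis by fact
  interpret unitary_Lambda_module smul Basis act
    by standard (rule assms)+
  show ?thesis
    \<comment> \<open>The first two facts ensure that the definite descriptions behind f(L) and
      \<open>K\<close> denote actual sums. The last conjunct holds by unfolding, as
      \<open>q_power\<close> of \<open>H\<close> is \<open>K\<close>.\<close>
    using operator_series_sums[OF endo_L f_series_conv_radius]
      operator_series_sums[OF endo_cH fps_conv_radius_exp] ex1_UqH_action
    by (auto simp: realizes_assignment_def q_power_def K_op_def)
qed

end
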